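(* Suppose $0<p_0,p_1<1$, with $p_1$ and $p_0$ both bounded away from $0$ and $1$. Let $\log(\mathrm{CRR})=\log(p_1)-\log(p_0)$ and $\log(\widehat{\mathrm{CRR}})=\log(\widehat p_1)-\log(\widehat p_0)$. As $N\to\infty$, $\log(\widehat{\mathrm{CRR}})$ is consistent for $\log(\mathrm{CRR})$ and asymptotically Normal with asymptotic variance $$\frac{N_1p_1+N_0p_0}{N\,p_1p_0}\left(\frac{S_1^2}{N_1p_1}+\frac{S_0^2}{N_0p_0}-\frac{S_\tau^2}{N_1p_1+N_0p_0}\right).$$ Assuming $S_\tau^2=0$, as in Neyman (1923), the asymptotic variance can be estimated by $$\widehat V_{\mathrm{CRR}}=\frac{n_{10}}{n_{11}N_1}\,\frac{(n_{11}+n_{01})N_0}{n_{01}N}+\frac{n_{00}}{n_{01}N_0}\,\frac{(n_{11}+n_{01})N_1}{n_{11}N}.$$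
   Context: There are $N$ units with fixed (non-random) binary potential outcomes $(Y_i(1),Y_i(0))\in\{0,1\}^2$ under treatment and control, $i=1,\dots,N$. For $t=0,1$: $p_t=\frac1N\sum_{i=1}^NY_i(t)$ and $S_t^2=\frac1{N-1}\sum_{i=1}^N\{Y_i(t)-p_t\}^2$. Also $\tau_i=Y_i(1)-Y_i(0)$, $\tau=\frac1N\sum_{i=1}^N\tau_i=p_1-p_0$, and $S_\tau^2=\frac1{N-1}\sum_{i=1}^N(\tau_i-\tau)^2$. CRR stands for the causal risk ratio. In a completely randomized experiment, $\boldsymbol W=(W_1,\dots,W_N)\in\{0,1\}^N$ is uniformly distributed over vectors with exactly $N_1$ ones ($N_1$ fixed, $N_0=N-N_1$); this is the only source of randomness. Observed outcomes are $Y_i^{\mathrm{obs}}=W_iY_i(1)+(1-W_i)Y_i(0)$. Counts: $n_{11}$ = number of $i$ with $W_i=1,Y_i^{\mathrm{obs}}=1$; $n_{10}$ = number with $W_i=1,Y_i^{\mathrm{obs}}=0$; $n_{01}$ = number with $W_i=0,Y_i^{\mathrm{obs}}=1$; $n_{00}$ = number with $W_i=0,Y_i^{\mathrm{obs}}=0$. Put $\widehat p_1=n_{11}/N_1$ and $\widehat p_0=n_{01}/N_0$.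
   Formalization: Both N_1 and N_0 are assumed to tend to infinity, and asymptotic Normality is claimed only when min(N_1,N_0)^2 times the asymptotic variance tends to infinity; without this it fails, e.g. if Y_i(1)=1-Y_i(0) and p_1=N_0/N, where the variance is 0. *)

theory Defs
  imports "HOL-Probability.Probability"
begin

text \<open>
  The units are \<open>1, \<dots>, N\<close>. Potential outcomes and treatment indicators are functions
  \<open>nat \<Rightarrow> real\<close> with values in \<open>{0, 1}\<close> on \<open>{1..N}\<close>; \<open>y1\<close> and \<open>y0\<close> are the
  outcomes under treatment and under control, and \<open>n1\<close> is the number of treated units.
\<close>

definition pop_mean :: "nat \<Rightarrow> (nat \<Rightarrow> real) \<Rightarrow> real" where
  "pop_mean N y = (\<Sum>i=1..N. y i) / real N"

definition pop_var :: "nat \<Rightarrow> (nat \<Rightarrow> real) \<Rightarrow> real" where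
  "pop_var N y = (\<Sum>i=1..N. (y i - pop_mean N y)\<^sup>2) / (real N - 1)"

definition unit_effect :: "(nat \<Rightarrow> real) \<Rightarrow> (nat \<Rightarrow> real) \<Rightarrow> nat \<Rightarrow> real" where
  "unit_effect y1 y0 i = y1 i - y0 i"

definition assignments :: "nat \<Rightarrow> nat \<Rightarrow> (nat \<Rightarrow> real) set" where
  "assignments N n1 = {W \<in> {1..N} \<rightarrow>\<^sub>E {0, 1}. (\<Sum>i=1..N. W i) = real n1}"

text \<open>For \<open>n1 > N\<close> there is no assignment and \<open>cre N n1\<close> is unspecified.\<close>

definition cre :: "nat \<Rightarrow> nat \<Rightarrow> (nat \<Rightarrow> real) pmf" where
  "cre N n1 = pmf_of_set (assignments N n1)"

definition y_obs :: "(nat \<Rightarrow> real) \<Rightarrow> (nat \<Rightarrow> real) \<Rightarrow> (nat \<Rightarrow> real) \<Rightarrow> nat \<Rightarrow> real" where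
  "y_obs y1 y0 W i = W i * y1 i + (1 - W i) * y0 i"

text \<open>\<open>cell N y1 y0 w y W\<close> is the count \<open>n\<^sub>w\<^sub>y\<close>: treatment index first, observed outcome second.\<close>

definition cell ::
    "nat \<Rightarrow> (nat \<Rightarrow> real) \<Rightarrow> (nat \<Rightarrow> real) \<Rightarrow> real \<Rightarrow> real \<Rightarrow> (nat \<Rightarrow> real) \<Rightarrow> real" where
  "cell N y1 y0 w y W = real (card {i \<in> {1..N}. W i = w \<and> y_obs y1 y0 W i = y})"

definition p1_hat :: "nat \<Rightarrow> nat \<Rightarrow> (nat \<Rightarrow> real) \<Rightarrow> (nat \<Rightarrow> real) \<Rightarrow> (nat \<Rightarrow> real) \<Rightarrow> real" where
  "p1_hat N n1 y1 y0 W = cell N y1 y0 1 1 W / real n1"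

definition p0_hat :: "nat \<Rightarrow> nat \<Rightarrow> (nat \<Rightarrow> real) \<Rightarrow> (nat \<Rightarrow> real) \<Rightarrow> (nat \<Rightarrow> real) \<Rightarrow> real" where
  "p0_hat N n1 y1 y0 W = cell N y1 y0 0 1 W / real (N - n1)"

definition log_crr :: "nat \<Rightarrow> (nat \<Rightarrow> real) \<Rightarrow> (nat \<Rightarrow> real) \<Rightarrow> real" where
  "log_crr N y1 y0 = ln (pop_mean N y1) - ln (pop_mean N y0)"

text \<open>
  Since \<open>ln 0 = 0\<close> and \<open>x / 0 = 0\<close>, the two statistics \<open>log_crr_hat\<close> and \<open>v_crr_hat\<close> get
  conventional values on the assignments with \<open>n\<^sub>1\<^sub>1 = 0\<close> or \<open>n\<^sub>0\<^sub>1 = 0\<close>; under the hypotheses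
  of interest these have probability tending to 0.
\<close>

definition log_crr_hat ::
    "nat \<Rightarrow> nat \<Rightarrow> (nat \<Rightarrow> real) \<Rightarrow> (nat \<Rightarrow> real) \<Rightarrow> (nat \<Rightarrow> real) \<Rightarrow> real" where
  "log_crr_hat N n1 y1 y0 W = ln (p1_hat N n1 y1 y0 W) - ln (p0_hat N n1 y1 y0 W)"

text \<open>
  Linearising the logarithms, \<open>avar_crr\<close> is the exact variance of
  \<open>(p1_hat - p1) / p1 - (p0_hat - p0) / p0\<close>. It can vanish: if \<open>y1 = 1 - y0\<close> and \<open>p1 = N0 / N\<close>, then
  \<open>n\<^sub>1\<^sub>1 = n\<^sub>0\<^sub>1\<close> and \<open>log_crr_hat = log_crr\<close> for every assignment. Asymptotic normality therefore
  needs a nondegeneracy condition; \<open>(min N1 N0)\<^sup>2 * avar_crr \<longrightarrow> \<infinity>\<close> says that the contribution of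
  each single unit is negligible.
\<close>

definition avar_crr :: "nat \<Rightarrow> nat \<Rightarrow> (nat \<Rightarrow> real) \<Rightarrow> (nat \<Rightarrow> real) \<Rightarrow> real" where
  "avar_crr N n1 y1 y0 =
    (let N1 = real n1; N0 = real (N - n1);
         p1 = pop_mean N y1; p0 = pop_mean N y0
     in (N1 * p1 + N0 * p0) / (real N * p1 * p0) *
        (pop_var N y1 / (N1 * p1) + pop_var N y0 / (N0 * p0)
          - pop_var N (unit_effect y1 y0) / (N1 * p1 + N0 * p0)))"

definition v_crr_hat ::
    "nat \<Rightarrow> nat \<Rightarrow> (nat \<Rightarrow> real) \<Rightarrow> (nat \<Rightarrow> real) \<Rightarrow> (nat \<Rightarrow> real) \<Rightarrow> real" where
  "v_crr_hat N n1 y1 y0 W =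
    (let N1 = real n1; N0 = real (N - n1);
         n11 = cell N y1 y0 1 1 W; n10 = cell N y1 y0 1 0 W;
         n01 = cell N y1 y0 0 1 W; n00 = cell N y1 y0 0 0 W
     in n10 / (n11 * N1) * ((n11 + n01) * N0 / (n01 * real N))
      + n00 / (n01 * N0) * ((n11 + n01) * N1 / (n11 * real N)))"

text \<open>Convergence in probability to a constant, where the probability space may vary with the index.\<close>

definition tendsto_in_prob :: "(nat \<Rightarrow> 'a pmf) \<Rightarrow> (nat \<Rightarrow> 'a \<Rightarrow> real) \<Rightarrow> real \<Rightarrow> bool" where
  "tendsto_in_prob P X c \<longleftrightarrow>
    (\<forall>\<epsilon>>0. (\<lambda>N. measure_pmf.prob (P N) {\<omega>. \<bar>X N \<omega> - c\<bar> > \<epsilon>}) \<longlonglongrightarrow> 0)"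

end

theory Submission
  imports Defs
begin


text \<open>
  The proof has two independent halves: a central limit theorem for the sum \<open>\<Sum>i. W i * a i\<close> of the
  scores drawn into the treatment arm, and a reduction of the log risk ratio to such a sum.

  The central limit theorem is obtained by Stein's method with an exchangeable pair. Exchanging a
  random treated unit \<open>i\<close> with a random control unit \<open>j\<close> turns a uniform assignment into a uniform
  assignment, and moves the sum \<open>T\<close> of centred scores by \<open>a j - a i\<close>. The mean of this move
  is exactly proportional to \<open>-T\<close>. This yields an integration by parts formula
  (\<open>stein_identity\<close>) that gives the first two moments of \<open>T\<close> at once and, applied to
  \<open>x \<mapsto> exp (\<i> t x)\<close>, shows that the characteristic function \<open>\<phi>\<close> of a standardised \<open>T\<close> nearly
  solves \<open>\<phi>' = - t \<phi>\<close>, the equation of \<open>exp (- t\<^sup>2 / 2)\<close>. The defect is controlled by how much the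
  squared size of the move, averaged over \<open>i\<close> and \<open>j\<close>, fluctuates with the assignment. That average
  depends on the assignment only through \<open>T\<^sup>2\<close> and the drawn sum of \<open>(a i)\<^sup>2\<close>, so the variance formula
  bounds it again (\<open>swap_sq_concentration\<close>). The resulting error bound \<open>char_tsum_bound\<close>
  is explicit in \<open>N\<close> and \<open>M = max \<bar>a i\<bar>\<close>, and does not depend on the fraction of treated units,
  which may therefore tend to 0 or 1.

  For the second half write \<open>p1_hat = p1 * (1 + err1)\<close> and \<open>p0_hat = p0 * (1 + err0)\<close>. The error of
  the log risk ratio is \<open>ln (1 + err1) - ln (1 + err0)\<close>. Its linear part \<open>err1 - err0\<close> is a drawn sum of
  centred scores of size \<open>O(1/m)\<close>, where \<open>m\<close> is the size of the smaller arm, and its variance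
  is exactly \<open>avar_crr\<close>. The remainder is at most \<open>2 * (err1\<^sup>2 + err0\<^sup>2)\<close>, whose mean is also
  \<open>O(1/m)\<close>. Divided by the standard deviation \<open>s\<close>, both the scores and the remainder vanish when
  \<open>m * s \<longrightarrow> \<infinity>\<close>, which is the nondegeneracy condition.

  A vanishing variance of the unit effects forces \<open>y1 = y0\<close>, since a constant nonzero effect
  would put one of the two proportions at 0 or 1. The estimated variance divided by the true one then is a quotient of
  factors that tend to 1 together with \<open>err1\<close> and \<open>err0\<close>.
\<close>


section \<open>Elementary inequalities and convergence to the normal law\<close>

lemma integral_pmf_nonneg_markov:
  fixes X :: "'a \<Rightarrow> real"
  assumes "finite (set_pmf p)" and "0 < c" and "\<And>w. 0 \<le> X w"
  shows "measure_pmf.prob p {w. c \<le> X w} \<le> measure_pmf.expectation p X / c"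
  using integral_Markov_inequality_measure[of "measure_pmf p" X UNIV c] assms
  by (simp add: integrable_measure_pmf_finite)

lemma sum_sq_deviation_le:
  "(\<Sum>i=1..N. (a i - pop_mean N a)\<^sup>2) \<le> (\<Sum>i=1..N. (a i)\<^sup>2)"
proof -
  let ?m = "pop_mean N a"
  have s: "(\<Sum>i=1..N. a i) = real N * ?m" by (cases "N = 0") (auto simp: pop_mean_def)
  have "(\<Sum>i=1..N. (a i - ?m)\<^sup>2) = (\<Sum>i=1..N. (a i)\<^sup>2) - 2 * ?m * (\<Sum>i=1..N. a i) + real N * ?m\<^sup>2"
    by (simp add: power2_diff sum.distrib sum_subtractf sum_distrib_left mult_ac)
  also have "\<dots> = (\<Sum>i=1..N. (a i)\<^sup>2) - real N * ?m\<^sup>2"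
    unfolding s by (simp add: power2_eq_square)
  finally show ?thesis by simp
qed

text \<open>
  The constant 8 comes from the two polynomial inequalities
  \<open>(1 + k)\<^sup>2 \<le> (1 + 8 k) (1 - k)\<^sup>2\<close> and \<open>(1 - 8 k) (1 + k)\<^sup>2 \<le> (1 - k)\<^sup>3\<close>, the first of which
  needs \<open>k \<le> 1/4\<close>.
\<close>

lemma ratio_near_one:
  fixes k r u v x z :: real
  assumes k: "0 < k" "k \<le> 1 / 4"
    and r: "1 - k \<le> r" "r \<le> 1"
    and near: "\<bar>u - 1\<bar> \<le> k" "\<bar>v - 1\<bar> \<le> k" "\<bar>x - 1\<bar> \<le> k" "\<bar>z - 1\<bar> \<le> k"
  shows "\<bar>r * (u * v) / (x * z) - 1\<bar> \<le> 8 * k"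
proof -
  have b: "1 - k \<le> u" "u \<le> 1 + k" "1 - k \<le> v" "v \<le> 1 + k" "1 - k \<le> x" "x \<le> 1 + k"
    "1 - k \<le> z" "z \<le> 1 + k" using near by auto
  have k1: "0 < 1 - k" using k by simp
  have xz: "(1 - k) * (1 - k) \<le> x * z" "x * z \<le> (1 + k) * (1 + k)"
    using b k1 k by (auto intro!: mult_mono)
  have xz0: "0 < x * z" using xz(1) k1 by (meson less_le_trans mult_pos_pos)
  have uv: "(1 - k) * (1 - k) \<le> u * v" "u * v \<le> (1 + k) * (1 + k)"
    using b k1 k by (auto intro!: mult_mono)
  have uv0: "0 \<le> u * v" using uv(1) k1 by (meson order_trans mult_nonneg_nonneg less_imp_le)
  have "r * (u * v) \<le> 1 * ((1 + k) * (1 + k))"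
    using mult_mono[OF r(2) uv(2)] uv0 by simp
  also have "\<dots> \<le> (1 + 8 * k) * ((1 - k) * (1 - k))"
  proof -
    have "0 \<le> 4 * k * (1 - 4 * k) + 8 * k * k * k" using k by simp
    then show ?thesis by (simp add: algebra_simps)
  qed
  also have "\<dots> \<le> (1 + 8 * k) * (x * z)" using xz k by (intro mult_left_mono) auto
  finally have up: "r * (u * v) / (x * z) \<le> 1 + 8 * k" using xz0 by (simp add: divide_le_eq)
  have "(1 - 8 * k) * (x * z) \<le> (1 - k) * ((1 - k) * (1 - k))"
  proof (cases "1 - 8 * k \<le> 0")
    case True
    then have "(1 - 8 * k) * (x * z) \<le> 0" using xz0 by (simp add: mult_nonpos_nonneg)
    also have "0 \<le> (1 - k) * ((1 - k) * (1 - k))" using k1 by simp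
    finally show ?thesis .
  next
    case False
    then have "(1 - 8 * k) * (x * z) \<le> (1 - 8 * k) * ((1 + k) * (1 + k))"
      using xz by (intro mult_left_mono) auto
    also have "\<dots> \<le> (1 - k) * ((1 - k) * (1 - k))"
    proof -
      have "0 \<le> 3 * k + 18 * k * k + 7 * k * k * k" using k by simp
      then show ?thesis by (simp add: algebra_simps)
    qed
    finally show ?thesis .
  qed
  also have "\<dots> \<le> r * (u * v)" using mult_mono[OF r(1) uv(1)] r k1 by simp
  finally have "1 - 8 * k \<le> r * (u * v) / (x * z)" using xz0 by (simp add: le_divide_eq)
  with up show ?thesis by (simp add: abs_le_iff)
qed

text \<open>
  Levy's continuity theorem for statistics that live on a different probability space for each \<open>N\<close>.
\<close>

lemma weak_conv_std_normal_if_char: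
  fixes P :: "nat \<Rightarrow> 'a pmf" and X :: "nat \<Rightarrow> 'a \<Rightarrow> real"
  assumes "\<And>t. (\<lambda>N. measure_pmf.expectation (P N) (\<lambda>w. iexp (t * X N w))) \<longlonglongrightarrow> of_real (exp (- t\<^sup>2 / 2))"
  shows "weak_conv_m (\<lambda>N. distr (measure_pmf (P N)) borel (X N)) std_normal_distribution"
proof (rule levy_continuity)
  show "real_distribution (distr (measure_pmf (P N)) borel (X N))" for N
    by (rule prob_space.real_distribution_distr[OF measure_pmf.prob_space_axioms]) simp
  show "(\<lambda>N. char (distr (measure_pmf (P N)) borel (X N)) t) \<longlonglongrightarrow> char std_normal_distribution t" for t
  proof -
    have "char (distr (measure_pmf (P N)) borel (X N)) t =
        measure_pmf.expectation (P N) (\<lambda>w. iexp (t * X N w))" for N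
      unfolding char_def by (subst integral_distr) simp_all
    then show ?thesis using assms[of t] by (simp add: char_std_normal_distribution)
  qed
qed (rule real_dist_normal_dist)

section \<open>Exchanging a treated and a control unit\<close>

locale completely_randomized =
  fixes N n :: nat
  assumes n_pos: "0 < n" and n_less: "n < N"
begin

abbreviation E :: "((nat \<Rightarrow> real) \<Rightarrow> 'b::{banach, second_countable_topology}) \<Rightarrow> 'b" where
  "E f \<equiv> measure_pmf.expectation (cre N n) f"

definition treated :: "(nat \<Rightarrow> real) \<Rightarrow> nat set" where
  "treated W = {i \<in> {1..N}. W i = 1}"

definition untreated :: "(nat \<Rightarrow> real) \<Rightarrow> nat set" where
  "untreated W = {i \<in> {1..N}. W i = 0}"

definition tsum :: "(nat \<Rightarrow> real) \<Rightarrow> (nat \<Rightarrow> real) \<Rightarrow> real" where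
  "tsum a W = (\<Sum>i=1..N. W i * a i)"

lemma finite_assignments: "finite (assignments N n)"
  unfolding assignments_def by (rule finite_subset[of _ "{1..N} \<rightarrow>\<^sub>E {0, 1}"]) (auto intro: finite_PiE)

lemma assignments_nonempty: "assignments N n \<noteq> {}"
proof -
  define W where "W = restrict (\<lambda>i. if i \<le> n then 1 else 0 :: real) {1..N}"
  have "(\<Sum>i=1..N. W i) = (\<Sum>i=1..N. if i \<le> n then 1 else 0)"
    unfolding W_def by (rule sum.cong) auto
  also have "\<dots> = real (card ({1..N} \<inter> {i. i \<le> n}))"
    by (simp add: sum.If_cases)
  also have "{1..N} \<inter> {i. i \<le> n} = {1..n}" using n_less by auto
  finally have "W \<in> assignments N n"
    unfolding assignments_def W_def by auto
  then show ?thesis by auto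
qed

lemma set_pmf_cre: "set_pmf (cre N n) = assignments N n"
  unfolding cre_def by (rule set_pmf_of_set[OF assignments_nonempty finite_assignments])

lemma integrable_cre [simp]:
  fixes f :: "(nat \<Rightarrow> real) \<Rightarrow> 'b::{banach, second_countable_topology}"
  shows "integrable (measure_pmf (cre N n)) f"
  by (rule integrable_measure_pmf_finite) (simp add: set_pmf_cre finite_assignments)

lemma E_eq_sum:
  fixes f :: "(nat \<Rightarrow> real) \<Rightarrow> 'b::{banach, second_countable_topology}"
  shows "E f = (1 / real (card (assignments N n))) *\<^sub>R (\<Sum>W\<in>assignments N n. f W)"
  by (subst integral_measure_pmf[OF finite_assignments])
     (auto simp: set_pmf_cre cre_def assignments_nonempty finite_assignments scaleR_sum_right)

lemma E_cong:
  fixes f :: "(nat \<Rightarrow> real) \<Rightarrow> 'b::{banach, second_countable_topology}"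
  assumes "\<And>W. W \<in> assignments N n \<Longrightarrow> f W = g W"
  shows "E f = E g"
  unfolding E_eq_sum using assms by simp

lemma E_mono:
  fixes f g :: "(nat \<Rightarrow> real) \<Rightarrow> real"
  assumes "\<And>W. W \<in> assignments N n \<Longrightarrow> f W \<le> g W"
  shows "E f \<le> E g"
  unfolding E_eq_sum using assms by (simp add: sum_mono divide_right_mono)

lemma E_norm:
  fixes f :: "(nat \<Rightarrow> real) \<Rightarrow> 'b::{banach, second_countable_topology}"
  assumes "\<And>W. W \<in> assignments N n \<Longrightarrow> norm (f W) \<le> g W"
  shows "norm (E f) \<le> E g"
  by (rule order_trans[OF integral_norm_bound E_mono]) (use assms in auto)

lemma assignment_cases:
  assumes "W \<in> assignments N n" "i \<in> {1..N}"
  shows "W i = 0 \<or> W i = 1"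
  using assms unfolding assignments_def by (auto simp: PiE_iff)

lemma sum_treated:
  assumes "W \<in> assignments N n"
  shows "(\<Sum>i\<in>treated W. a i) = tsum a W"
proof -
  have "(\<Sum>i\<in>treated W. a i) = (\<Sum>i=1..N. if W i = 1 then a i else 0)"
    unfolding treated_def by (subst sum.inter_filter) auto
  also have "\<dots> = tsum a W"
    unfolding tsum_def by (rule sum.cong) (use assignment_cases[OF assms] in auto)
  finally show ?thesis .
qed

lemma sum_untreated:
  assumes "W \<in> assignments N n"
  shows "(\<Sum>i\<in>untreated W. a i) = (\<Sum>i=1..N. a i) - tsum a W"
proof -
  have "(\<Sum>i\<in>untreated W. a i) = (\<Sum>i=1..N. if W i = 0 then a i else 0)"
    unfolding untreated_def by (subst sum.inter_filter) auto
  also have "\<dots> = (\<Sum>i=1..N. a i - W i * a i)"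
    by (rule sum.cong) (use assignment_cases[OF assms] in auto)
  finally show ?thesis by (simp add: tsum_def sum_subtractf)
qed

lemma card_treated: "W \<in> assignments N n \<Longrightarrow> real (card (treated W)) = real n"
  using sum_treated[of W "\<lambda>_. 1"] by (simp add: tsum_def assignments_def)

lemma card_untreated: "W \<in> assignments N n \<Longrightarrow> real (card (untreated W)) = real N - real n"
  using sum_untreated[of W "\<lambda>_. 1"] by (simp add: tsum_def assignments_def)

lemma tsum_swap:
  assumes "i \<in> treated W" "j \<in> untreated W"
  shows "tsum a (W(i := 0, j := 1)) = tsum a W + (a j - a i)"
proof -
  have ij: "i \<in> {1..N}" "j \<in> {1..N}" "W i = 1" "W j = 0" "i \<noteq> j"
    using assms by (auto simp: treated_def untreated_def)
  have "tsum a (W(i := 0, j := 1)) = 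
      (\<Sum>k=1..N. W k * a k + (if k = j then a j else 0) - (if k = i then a i else 0))"
    unfolding tsum_def by (rule sum.cong) (use ij in auto)
  also have "\<dots> = tsum a W + (a j - a i)"
    using ij(1,2) by (simp add: sum.distrib sum_subtractf tsum_def)
  finally show ?thesis .
qed

lemma swap_in_assignments:
  assumes "W \<in> assignments N n" "i \<in> treated W" "j \<in> untreated W"
  shows "W(i := 0, j := 1) \<in> assignments N n"
proof -
  have "tsum (\<lambda>_. 1) (W(i := 0, j := 1)) = real n"
    using tsum_swap[OF assms(2,3), of "\<lambda>_. 1"] assms(1)
    by (simp add: assignments_def tsum_def)
  then show ?thesis
    using assms by (auto simp: assignments_def tsum_def treated_def untreated_def PiE_iff extensional_def)
qed

text \<open>
  The map that exchanges the roles of \<open>i\<close> and \<open>j\<close> in a triple of an assignment, a treated unit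
  \<open>i\<close> and a control unit \<open>j\<close> is an involution of the set of all such triples. This is the
  exchangeability on which all moment computations rest.
\<close>

lemma E_swap:
  fixes F :: "(nat \<Rightarrow> real) \<Rightarrow> nat \<Rightarrow> nat \<Rightarrow> 'b::{banach, second_countable_topology}"
  shows "E (\<lambda>W. \<Sum>i\<in>treated W. \<Sum>j\<in>untreated W. F W i j) =
         E (\<lambda>W. \<Sum>i\<in>treated W. \<Sum>j\<in>untreated W. F (W(i := 0, j := 1)) j i)"
proof -
  let ?S = "Sigma (assignments N n) (\<lambda>W. treated W \<times> untreated W)"
  let ?h = "\<lambda>(W, i, j). (W(i := 0, j := 1), j, i)"
  have fin: "finite (treated W)" "finite (untreated W)" for W
    by (auto simp: treated_def untreated_def)
  have unnest: "(\<Sum>W\<in>assignments N n. \<Sum>i\<in>treated W. \<Sum>j\<in>untreated W. G W i j) =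
      (\<Sum>(W, i, j)\<in>?S. G W i j)" for G :: "(nat \<Rightarrow> real) \<Rightarrow> nat \<Rightarrow> nat \<Rightarrow> 'b"
    by (simp add: sum.Sigma finite_assignments fin sum.cartesian_product split_beta)
  have maps: "?h x \<in> ?S" if "x \<in> ?S" for x
    using that swap_in_assignments by (auto simp: treated_def untreated_def)
  have invol: "?h (?h x) = x" if "x \<in> ?S" for x
    using that by (auto simp: treated_def untreated_def fun_eq_iff)
  have undo: "(case ?h x of (W, i, j) \<Rightarrow> F (W(i := 0, j := 1)) j i) = (case x of (W, i, j) \<Rightarrow> F W i j)"
    if "x \<in> ?S" for x
    using invol[OF that] by (auto split: prod.splits)
  have "(\<Sum>(W, i, j)\<in>?S. F W i j) = (\<Sum>(W, i, j)\<in>?S. F (W(i := 0, j := 1)) j i)"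
    by (rule sum.reindex_bij_witness[where i = ?h and j = ?h])
       (fact invol maps undo)+
  then show ?thesis
    unfolding E_eq_sum unnest by simp
qed

text \<open>
  Summed over all exchanges, \<open>a j - a i\<close> gives \<open>-N * T\<close>, because the control units carry
  \<open>-T\<close> when the scores add up to 0. Weighted by \<open>g T\<close>, the same sum changes sign
  and gets \<open>g (T + (a j - a i))\<close> in place of \<open>g T\<close> under the exchange. The formula is half the
  difference of the two expressions. With \<open>g = 1\<close> it gives the mean of \<open>T\<close>, with the identity it gives
  the variance.
\<close>

lemma stein_identity:
  fixes g :: "real \<Rightarrow> 'b::{banach, second_countable_topology}"
  assumes centred: "(\<Sum>i=1..N. a i) = 0"
  shows "real N *\<^sub>R E (\<lambda>W. tsum a W *\<^sub>R g (tsum a W)) =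
    (1 / 2) *\<^sub>R E (\<lambda>W. \<Sum>i\<in>treated W. \<Sum>j\<in>untreated W.
       (a j - a i) *\<^sub>R (g (tsum a W + (a j - a i)) - g (tsum a W)))"
proof -
  let ?D = "\<lambda>W. \<Sum>i\<in>treated W. \<Sum>j\<in>untreated W. (a j - a i) *\<^sub>R g (tsum a W)"
  let ?D' = "\<lambda>W. \<Sum>i\<in>treated W. \<Sum>j\<in>untreated W. (a j - a i) *\<^sub>R g (tsum a W + (a j - a i))"
  have drift: "?D W = - (real N *\<^sub>R (tsum a W *\<^sub>R g (tsum a W)))" if "W \<in> assignments N n" for W
  proof -
    have "?D W = (\<Sum>i\<in>treated W. \<Sum>j\<in>untreated W. a j - a i) *\<^sub>R g (tsum a W)"
      by (simp only: scaleR_sum_left)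
    also have "(\<Sum>i\<in>treated W. \<Sum>j\<in>untreated W. a j - a i) = - (real N * tsum a W)"
    proof -
      have "(\<Sum>i\<in>treated W. \<Sum>j\<in>untreated W. a j - a i) =
          (\<Sum>i\<in>treated W. - tsum a W - (real N - real n) * a i)"
        using sum_untreated[OF that, of a] centred card_untreated[OF that]
        by (simp add: sum_subtractf)
      also have "\<dots> = - (real n * tsum a W) - (real N - real n) * tsum a W"
        using sum_treated[OF that, of a] card_treated[OF that]
        by (simp only: sum_subtractf sum_distrib_left[symmetric]) simp
      finally show ?thesis by (simp add: algebra_simps)
    qed
    finally show ?thesis by simp
  qed
  have ED: "E ?D = - (real N *\<^sub>R E (\<lambda>W. tsum a W *\<^sub>R g (tsum a W)))"
    by (subst E_cong[OF drift]) (simp_all del: scaleR_scaleR)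
  have "E ?D = E (\<lambda>W. \<Sum>i\<in>treated W. \<Sum>j\<in>untreated W.
      (a i - a j) *\<^sub>R g (tsum a (W(i := 0, j := 1))))"
    by (rule E_swap)
  also have "\<dots> = E (\<lambda>W. - ?D' W)"
    by (rule E_cong) (simp add: tsum_swap sum_negf[symmetric] scaleR_left.minus[symmetric])
  finally have sw: "E ?D = - E ?D'" by simp
  have "E (\<lambda>W. \<Sum>i\<in>treated W. \<Sum>j\<in>untreated W.
       (a j - a i) *\<^sub>R (g (tsum a W + (a j - a i)) - g (tsum a W))) = E (\<lambda>W. ?D' W - ?D W)"
    by (simp only: scaleR_diff_right sum_subtractf)
  also have "\<dots> = E ?D' - E ?D" by simp
  also have "\<dots> = 2 *\<^sub>R (real N *\<^sub>R E (\<lambda>W. tsum a W *\<^sub>R g (tsum a W)))"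
    using sw ED by (simp add: scaleR_2)
  finally show ?thesis by simp
qed

lemma E_tsum_centred:
  assumes "(\<Sum>i=1..N. a i) = 0"
  shows "E (tsum a) = 0"
  using stein_identity[OF assms, of "\<lambda>_. 1::real"] n_less by simp

lemma tsum_center: "W \<in> assignments N n \<Longrightarrow> tsum (\<lambda>i. a i - c) W = tsum a W - real n * c"
  by (simp add: tsum_def algebra_simps sum_subtractf sum_distrib_left[symmetric] assignments_def)

lemma E_tsum: "E (tsum a) = real n / real N * (\<Sum>i=1..N. a i)"
proof -
  let ?m = "pop_mean N a"
  have "E (\<lambda>W. tsum a W - real n * ?m) = E (tsum (\<lambda>i. a i - ?m))"
    by (rule E_cong) (simp add: tsum_center)
  also have "\<dots> = 0"
    using n_less by (intro E_tsum_centred) (simp add: sum_subtractf pop_mean_def)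
  finally show ?thesis by (simp add: pop_mean_def measure_pmf.prob_space)
qed

text \<open>
  In Stein's method this is, up to normalisation, the conditional second moment of the move of
  \<open>T\<close> given the assignment. For unit variance it has mean \<open>2 * N\<close>, and the normal approximation is good to
  the extent that it is concentrated there.
\<close>

definition swap_sq :: "(nat \<Rightarrow> real) \<Rightarrow> (nat \<Rightarrow> real) \<Rightarrow> real" where
  "swap_sq a W = (\<Sum>i\<in>treated W. \<Sum>j\<in>untreated W. (a j - a i)\<^sup>2)"

lemma swap_sq_eq:
  assumes "W \<in> assignments N n" "(\<Sum>i=1..N. a i) = 0"
  shows "swap_sq a W = real n * (\<Sum>i=1..N. (a i)\<^sup>2) + (real N - 2 * real n) * tsum (\<lambda>i. (a i)\<^sup>2) W
     + 2 * (tsum a W)\<^sup>2"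
proof -
  let ?s = "tsum (\<lambda>i. (a i)\<^sup>2) W" and ?q = "\<Sum>i=1..N. (a i)\<^sup>2" and ?t = "tsum a W"
  have u: "(\<Sum>j\<in>untreated W. a j) = - ?t"
    using sum_untreated[OF assms(1), of a] assms(2) by simp
  have "swap_sq a W = (\<Sum>i\<in>treated W. \<Sum>j\<in>untreated W. (a j)\<^sup>2 + (a i)\<^sup>2 - 2 * a i * a j)"
    unfolding swap_sq_def by (intro sum.cong) (auto simp: power2_eq_square algebra_simps)
  also have "\<dots> = (\<Sum>i\<in>treated W. (?q - ?s) + (real N - real n) * (a i)\<^sup>2 - 2 * a i * (- ?t))"
    using sum_untreated[OF assms(1), of "\<lambda>i. (a i)\<^sup>2"] card_untreated[OF assms(1)] u
    by (simp add: sum.distrib sum_subtractf sum_distrib_left[symmetric])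
  also have "\<dots> = real n * (?q - ?s) + (real N - real n) * ?s + 2 * ?t * ?t"
    using sum_treated[OF assms(1), of a] sum_treated[OF assms(1), of "\<lambda>i. (a i)\<^sup>2"]
      card_treated[OF assms(1)]
    by (simp add: sum.distrib sum_subtractf sum_negf sum_distrib_left[symmetric]
        sum_distrib_right[symmetric])
  finally show ?thesis by (simp add: power2_eq_square algebra_simps)
qed

lemma E_swap_sq:
  assumes "(\<Sum>i=1..N. a i) = 0"
  shows "E (swap_sq a) = 2 * real N * E (\<lambda>W. (tsum a W)\<^sup>2)"
  using stein_identity[OF assms, of "\<lambda>x. x"]
  by (simp add: swap_sq_def[abs_def] power2_eq_square)

text \<open>
  By \<open>swap_sq_eq\<close> the mean of \<open>swap_sq a\<close> involves only the variance of \<open>T\<close> itself and the mean of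
  another drawn sum, so that \<open>E_swap_sq\<close> becomes a linear equation for the variance.
\<close>

lemma variance_tsum:
  assumes "(\<Sum>i=1..N. a i) = 0"
  shows "E (\<lambda>W. (tsum a W)\<^sup>2) =
    real n * (real N - real n) / (real N * (real N - 1)) * (\<Sum>i=1..N. (a i)\<^sup>2)"
proof -
  let ?V = "E (\<lambda>W. (tsum a W)\<^sup>2)" and ?q = "\<Sum>i=1..N. (a i)\<^sup>2"
  have N: "real N > 1" using n_pos n_less by simp
  have "E (swap_sq a) = E (\<lambda>W. real n * ?q + (real N - 2 * real n) * tsum (\<lambda>i. (a i)\<^sup>2) W
     + 2 * (tsum a W)\<^sup>2)"
    by (rule E_cong) (rule swap_sq_eq[OF _ assms])
  also have "\<dots> = real n * ?q + (real N - 2 * real n) * (real n / real N * ?q) + 2 * ?V"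
    by (simp add: E_tsum measure_pmf.prob_space)
  finally have "2 * real N * ?V = real n * ?q + (real N - 2 * real n) * (real n / real N * ?q) + 2 * ?V"
    using E_swap_sq[OF assms] by simp
  then have "real N * (2 * (real N - 1) * ?V) = 2 * real n * (real N - real n) * ?q"
    using N by (simp add: field_simps)
  then show ?thesis using N by (simp add: field_simps)
qed

section \<open>A central limit theorem for sampling without replacement\<close>

text \<open>
  The random part of \<open>swap_sq a\<close> consists of \<open>T\<^sup>2\<close>, of mean 1, and of the drawn sum of the squared
  scores, with a factor of at most \<open>N\<close>. Since \<open>(a i)\<^sup>4 \<le> M\<^sup>2 * (a i)\<^sup>2\<close>, the variance of that drawn
  sum is at most \<open>M\<^sup>2\<close> times the variance of \<open>T\<close>, that is, at most \<open>M\<^sup>2\<close>.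
\<close>

lemma swap_sq_concentration:
  assumes centred: "(\<Sum>i=1..N. a i) = 0"
    and unit: "E (\<lambda>W. (tsum a W)\<^sup>2) = 1"
    and bound: "\<And>i. i \<in> {1..N} \<Longrightarrow> \<bar>a i\<bar> \<le> M"
  shows "E (\<lambda>W. \<bar>swap_sq a W - 2 * real N\<bar>) \<le> real N * M + 4"
proof -
  define q where "q = (\<Sum>i=1..N. (a i)\<^sup>2)"
  define m where "m = pop_mean N (\<lambda>i. (a i)\<^sup>2)"
  define U where "U = tsum (\<lambda>i. (a i)\<^sup>2 - m)"
  define c where "c = real n * (real N - real n) / (real N * (real N - 1))"
  have N: "real N > 1" using n_pos n_less by simp
  have c0: "c \<ge> 0" using n_less N by (simp add: c_def)
  have cq: "c * q = 1" using variance_tsum[OF centred] unfolding c_def q_def unit by (rule sym)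
  have M: "M > 0"
  proof (rule ccontr)
    assume "\<not> M > 0"
    then have "a i = 0" if "i \<in> {1..N}" for i using bound[OF that] by simp
    then have "q = 0" by (simp add: q_def)
    then show False using cq by simp
  qed
  have m: "real N * m = q" using N by (simp add: m_def q_def pop_mean_def)
  have "E (\<lambda>W. (U W)\<^sup>2) = c * (\<Sum>i=1..N. ((a i)\<^sup>2 - m)\<^sup>2)"
    unfolding U_def c_def using m by (intro variance_tsum) (simp add: sum_subtractf q_def)
  also have "\<dots> \<le> c * (\<Sum>i=1..N. ((a i)\<^sup>2)\<^sup>2)"
    using sum_sq_deviation_le[of "\<lambda>i. (a i)\<^sup>2"] c0 by (simp add: m_def mult_left_mono)
  also have "\<dots> \<le> c * (\<Sum>i=1..N. M\<^sup>2 * (a i)\<^sup>2)"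
  proof (intro mult_left_mono sum_mono c0)
    fix i assume "i \<in> {1..N}"
    then have "(a i)\<^sup>2 \<le> M\<^sup>2" using bound by (simp add: abs_le_square_iff[symmetric] M less_imp_le)
    then have "(a i)\<^sup>2 * (a i)\<^sup>2 \<le> M\<^sup>2 * (a i)\<^sup>2" by (intro mult_right_mono) auto
    then show "((a i)\<^sup>2)\<^sup>2 \<le> M\<^sup>2 * (a i)\<^sup>2" by (simp add: power2_eq_square)
  qed
  also have "\<dots> = M\<^sup>2 * (c * q)" by (simp add: q_def sum_distrib_left mult_ac)
  finally have U2: "E (\<lambda>W. (U W)\<^sup>2) \<le> M\<^sup>2" using cq by simp
  \<comment> \<open>From second to first moments by the arithmetic-geometric mean inequality with weight \<open>M\<close>\<close>
  have "E (\<lambda>W. \<bar>U W\<bar>) \<le> E (\<lambda>W. (U W)\<^sup>2 / (2 * M) + M / 2)"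
  proof (rule E_mono)
    fix W
    have "0 \<le> (\<bar>U W\<bar> - M)\<^sup>2" by simp
    then have "2 * M * \<bar>U W\<bar> \<le> (U W)\<^sup>2 + M\<^sup>2" by (simp add: power2_diff mult_ac)
    then show "\<bar>U W\<bar> \<le> (U W)\<^sup>2 / (2 * M) + M / 2"
      using M by (simp add: field_simps power2_eq_square)
  qed
  also have "\<dots> = E (\<lambda>W. (U W)\<^sup>2) / (2 * M) + M / 2"
    by (simp add: measure_pmf.prob_space)
  also have "\<dots> \<le> M\<^sup>2 / (2 * M) + M / 2"
    using U2 M by (intro add_mono divide_right_mono) auto
  finally have U1: "E (\<lambda>W. \<bar>U W\<bar>) \<le> M" using M by (simp add: power2_eq_square)
  have mean: "real n * q + (real N - 2 * real n) * (real n * m) + 2 = 2 * real N"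
  proof -
    have "2 * real N = E (swap_sq a)" using E_swap_sq[OF centred] unit by simp
    also have "\<dots> = E (\<lambda>W. real n * q + (real N - 2 * real n) * tsum (\<lambda>i. (a i)\<^sup>2) W
        + 2 * (tsum a W)\<^sup>2)"
      unfolding q_def by (rule E_cong) (rule swap_sq_eq[OF _ centred])
    also have "\<dots> = real n * q + (real N - 2 * real n) * (real n / real N * q) + 2"
      using unit by (simp add: E_tsum measure_pmf.prob_space q_def)
    also have "real n / real N * q = real n * m" using m N by (simp add: field_simps)
    finally show ?thesis by simp
  qed
  have "E (\<lambda>W. \<bar>swap_sq a W - 2 * real N\<bar>) \<le> E (\<lambda>W. real N * \<bar>U W\<bar> + 2 * ((tsum a W)\<^sup>2 + 1))"
  proof (rule E_mono)
    fix W assume W: "W \<in> assignments N n"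
    have "tsum (\<lambda>i. (a i)\<^sup>2) W = U W + real n * m"
      using tsum_center[OF W, of "\<lambda>i. (a i)\<^sup>2" m] by (simp add: U_def)
    then have "swap_sq a W = real n * q + ((real N - 2 * real n) * U W
        + (real N - 2 * real n) * (real n * m)) + 2 * (tsum a W)\<^sup>2"
      using swap_sq_eq[OF W centred] by (simp only: q_def distrib_left)
    moreover have "S = A + (B + C) + 2 * x \<Longrightarrow> A + C + 2 = 2 * y \<Longrightarrow> S - 2 * y = B + 2 * (x - 1)"
      for S A B C x y :: real by simp
    ultimately have "swap_sq a W - 2 * real N = (real N - 2 * real n) * U W + 2 * ((tsum a W)\<^sup>2 - 1)"
      using mean by blast
    also have "\<bar>\<dots>\<bar> \<le> \<bar>real N - 2 * real n\<bar> * \<bar>U W\<bar> + 2 * \<bar>(tsum a W)\<^sup>2 - 1\<bar>"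
      by (rule order_trans[OF abs_triangle_ineq]) (simp add: abs_mult del: right_diff_distrib_numeral)
    also have "\<dots> \<le> real N * \<bar>U W\<bar> + 2 * ((tsum a W)\<^sup>2 + 1)"
      using n_less by (intro add_mono mult_right_mono mult_left_mono) (auto simp: abs_le_iff)
    finally show "\<bar>swap_sq a W - 2 * real N\<bar> \<le> real N * \<bar>U W\<bar> + 2 * ((tsum a W)\<^sup>2 + 1)" .
  qed
  also have "\<dots> = real N * E (\<lambda>W. \<bar>U W\<bar>) + 4"
    using unit by (simp add: measure_pmf.prob_space)
  also have "\<dots> \<le> real N * M + 4" using U1 by (simp add: mult_left_mono)
  finally show ?thesis .
qed

text \<open>
  The left-hand side is the defect of the differential equation \<open>\<phi>' = - t \<phi>\<close> for the characteristic
  function. In \<open>stein_identity\<close> for \<open>g x = exp (\<i> t x)\<close>, replace the increment \<open>g (x + d) - g x\<close> by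
  \<open>\<i> t d * g x\<close>: the error is at most \<open>(t d)\<^sup>2 / 2\<close>, and what is left is \<open>swap_sq a\<close>
  times \<open>\<i> t * g T\<close>, where \<open>swap_sq a\<close> is close to \<open>2 * N\<close>.
\<close>

lemma stein_char_bound:
  assumes centred: "(\<Sum>i=1..N. a i) = 0"
    and unit: "E (\<lambda>W. (tsum a W)\<^sup>2) = 1"
    and bound: "\<And>i. i \<in> {1..N} \<Longrightarrow> \<bar>a i\<bar> \<le> M"
  shows "norm (E (\<lambda>W. tsum a W *\<^sub>R iexp (t * tsum a W)) - \<i> * t * E (\<lambda>W. iexp (t * tsum a W)))
    \<le> \<bar>t\<bar> * (M / 2 + 2 / real N) + t\<^sup>2 * M"
proof -
  let ?T = "tsum a" and ?Q = "swap_sq a"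
  have N: "real N > 0" using n_less by simp
  let ?S = "\<lambda>W. \<Sum>i\<in>treated W. \<Sum>j\<in>untreated W.
       (a j - a i) *\<^sub>R (iexp (t * (?T W + (a j - a i))) - iexp (t * ?T W))"
  have taylor: "norm (d *\<^sub>R (iexp (t * (x + d)) - iexp (t * x)) - \<i> * t * d\<^sup>2 * iexp (t * x)) \<le> t\<^sup>2 * M * d\<^sup>2"
    if "\<bar>d\<bar> \<le> 2 * M" for d x :: real
  proof -
    have "iexp (t * (x + d)) = iexp (t * x) * iexp (t * d)"
      by (simp add: exp_add[symmetric] algebra_simps)
    then have eq: "d *\<^sub>R (iexp (t * (x + d)) - iexp (t * x)) - \<i> * t * d\<^sup>2 * iexp (t * x) =
        of_real d * iexp (t * x) * (iexp (t * d) - 1 - \<i> * (t * d))"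
      by (simp add: scaleR_conv_of_real algebra_simps power2_eq_square)
    have "norm (iexp (t * d) - 1 - \<i> * (t * d)) \<le> (t * d)\<^sup>2 / 2"
      using iexp_approx1[of "t * d" 1] by (simp add: diff_diff_eq eval_nat_numeral)
    then have "norm (of_real d * iexp (t * x) * (iexp (t * d) - 1 - \<i> * (t * d))) \<le> \<bar>d\<bar> * ((t * d)\<^sup>2 / 2)"
      unfolding norm_mult norm_exp_i_times norm_of_real mult_1_right by (intro mult_left_mono) auto
    also have "\<dots> \<le> (2 * M) * ((t * d)\<^sup>2 / 2)"
      using that by (intro mult_right_mono) auto
    finally show ?thesis unfolding eq by (simp add: power_mult_distrib mult_ac)
  qed
  have pointwise: "norm (?S W - 2 * real N * (\<i> * t * iexp (t * ?T W))) \<le>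
      t\<^sup>2 * M * ?Q W + \<bar>t\<bar> * \<bar>?Q W - 2 * real N\<bar>" for W
  proof -
    have eq: "?S W - \<i> * t * ?Q W * iexp (t * ?T W) =
       (\<Sum>i\<in>treated W. \<Sum>j\<in>untreated W.
       (a j - a i) *\<^sub>R (iexp (t * (?T W + (a j - a i))) - iexp (t * ?T W))
         - \<i> * t * (a j - a i)\<^sup>2 * iexp (t * ?T W))"
      by (simp only: swap_sq_def of_real_sum sum_subtractf sum_distrib_left sum_distrib_right)
    have "norm (?S W - \<i> * t * ?Q W * iexp (t * ?T W)) \<le>
        (\<Sum>i\<in>treated W. \<Sum>j\<in>untreated W. t\<^sup>2 * M * (a j - a i)\<^sup>2)"
      unfolding eq
    proof (intro sum_norm_le)
      fix i j assume "i \<in> treated W" "j \<in> untreated W"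
      then have "\<bar>a i\<bar> \<le> M" "\<bar>a j\<bar> \<le> M" using bound by (auto simp: treated_def untreated_def)
      then have "\<bar>a j - a i\<bar> \<le> 2 * M" by linarith
      from taylor[OF this, of "?T W"]
      show "norm ((a j - a i) *\<^sub>R (iexp (t * (?T W + (a j - a i))) - iexp (t * ?T W))
         - \<i> * t * (a j - a i)\<^sup>2 * iexp (t * ?T W)) \<le> t\<^sup>2 * M * (a j - a i)\<^sup>2" 
        .
    qed
    also have "\<dots> = t\<^sup>2 * M * ?Q W"
      by (simp only: swap_sq_def sum_distrib_left)
    finally have 1: "norm (?S W - \<i> * t * ?Q W * iexp (t * ?T W)) \<le> t\<^sup>2 * M * ?Q W" .
    have "\<i> * t * ?Q W * iexp (t * ?T W) - 2 * real N * (\<i> * t * iexp (t * ?T W)) =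
      \<i> * iexp (t * ?T W) * of_real (t * (?Q W - 2 * real N))"
      by (simp add: algebra_simps)
    also have "norm \<dots> = \<bar>t\<bar> * \<bar>?Q W - 2 * real N\<bar>"
      by (simp only: norm_mult norm_of_real norm_exp_i_times) (simp add: abs_mult)
    finally have 2: "norm (\<i> * t * ?Q W * iexp (t * ?T W) - 2 * real N * (\<i> * t * iexp (t * ?T W)))
        = \<bar>t\<bar> * \<bar>?Q W - 2 * real N\<bar>" .
    from norm_triangle_ineq[of "?S W - \<i> * t * ?Q W * iexp (t * ?T W)"
        "\<i> * t * ?Q W * iexp (t * ?T W) - 2 * real N * (\<i> * t * iexp (t * ?T W))"] 1 2
    show ?thesis by simp
  qed
  have st: "real N *\<^sub>R E (\<lambda>W. ?T W *\<^sub>R iexp (t * ?T W)) = (1 / 2) *\<^sub>R E ?S"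
    by (rule stein_identity[OF centred, of "\<lambda>x. iexp (t * x)"])
  have eq: "2 * real N * (E (\<lambda>W. ?T W *\<^sub>R iexp (t * ?T W)) - \<i> * t * E (\<lambda>W. iexp (t * ?T W))) =
      E ?S - 2 * real N * (\<i> * t * E (\<lambda>W. iexp (t * ?T W)))"
  proof -
    have "of_real (2 * r) * (x - y) = s - of_real (2 * r) * y" if "r *\<^sub>R x = (1 / 2) *\<^sub>R s" for r and x y s :: complex
      using that by (simp add: scaleR_conv_of_real algebra_simps)
    from this[OF st] show ?thesis .
  qed
  have "E ?S - 2 * real N * (\<i> * t * E (\<lambda>W. iexp (t * ?T W))) =
      E (\<lambda>W. ?S W - 2 * real N * (\<i> * t * iexp (t * ?T W)))"
    by (subst Bochner_Integration.integral_diff) simp_all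
  note eq = trans[OF eq this]
  have "norm (2 * real N * (E (\<lambda>W. ?T W *\<^sub>R iexp (t * ?T W)) - \<i> * t * E (\<lambda>W. iexp (t * ?T W)))) \<le> E (\<lambda>W. t\<^sup>2 * M * ?Q W + \<bar>t\<bar> * \<bar>?Q W - 2 * real N\<bar>)"
    unfolding eq by (rule E_norm) (rule pointwise)
  also have "\<dots> = t\<^sup>2 * M * (2 * real N) + \<bar>t\<bar> * E (\<lambda>W. \<bar>?Q W - 2 * real N\<bar>)"
    using E_swap_sq[OF centred] unit by simp
  also have "\<dots> \<le> t\<^sup>2 * M * (2 * real N) + \<bar>t\<bar> * (real N * M + 4)"
    using swap_sq_concentration[OF assms] by (intro add_left_mono mult_left_mono) auto
  also have "\<dots> = 2 * real N * (\<bar>t\<bar> * (M / 2 + 2 / real N) + t\<^sup>2 * M)"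
    using N by (simp add: field_simps)
  finally show ?thesis using N by (simp add: norm_mult)
qed

text \<open>
  Multiplying the characteristic function by the integrating factor \<open>exp (t\<^sup>2 / 2)\<close> leaves a function
  with value 1 at 0 and small derivative, to which the mean value inequality applies.
\<close>

theorem char_tsum_bound:
  assumes centred: "(\<Sum>i=1..N. a i) = 0"
    and unit: "E (\<lambda>W. (tsum a W)\<^sup>2) = 1"
    and bound: "\<And>i. i \<in> {1..N} \<Longrightarrow> \<bar>a i\<bar> \<le> M"
  shows "norm (E (\<lambda>W. iexp (t * tsum a W)) - of_real (exp (- t\<^sup>2 / 2)))
    \<le> \<bar>t\<bar> * (\<bar>t\<bar> * (M / 2 + 2 / real N) + t\<^sup>2 * M)"
proof -
  let ?T = "tsum a"
  define \<phi> where "\<phi> s = E (\<lambda>W. iexp (s * ?T W))" for s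
  define \<phi>' where "\<phi>' s = \<i> * E (\<lambda>W. ?T W *\<^sub>R iexp (s * ?T W))" for s
  define \<psi> where "\<psi> s = \<phi> s * of_real (exp (s\<^sup>2 / 2))" for s
  let ?K = "\<bar>t\<bar> * (M / 2 + 2 / real N) + t\<^sup>2 * M"
  have "1 \<in> {1..N}" using n_less by simp
  from bound[OF this] have M: "M \<ge> 0" by simp
  have K: "?K \<ge> 0" using M by simp
  have der: "(\<phi> has_vector_derivative \<phi>' s) (at s within A)" for s A
  proof -
    have "((\<lambda>s. iexp (s * c)) has_vector_derivative \<i> * c * iexp (s * c)) (at s within A)" for c
    proof -
      have "((\<lambda>z. exp (\<i> * (z * of_real c))) has_field_derivative \<i> * c * iexp (s * c)) (at (of_real s))"
        by (auto intro!: derivative_eq_intros simp: mult_ac)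
      from has_vector_derivative_real_field[OF this, of A] show ?thesis by simp
    qed
    then have "(\<phi> has_vector_derivative (1 / real (card (assignments N n))) *\<^sub>R
        (\<Sum>W\<in>assignments N n. \<i> * ?T W * iexp (s * ?T W))) (at s within A)"
      unfolding \<phi>_def E_eq_sum
      by (intro bounded_linear.has_vector_derivative[OF bounded_linear_scaleR_right] has_vector_derivative_sum)
    then show ?thesis
      by (simp add: \<phi>'_def E_eq_sum scaleR_conv_of_real sum_distrib_left mult_ac)
  qed
  have der\<psi>: "(\<psi> has_vector_derivative (\<phi>' s + s * \<phi> s) * of_real (exp (s\<^sup>2 / 2))) (at s within A)" for s A
    unfolding \<psi>_def
    by (rule has_vector_derivative_eq_rhs, rule has_vector_derivative_mult[OF der],
        rule has_vector_derivative_of_real)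
       (auto intro!: derivative_eq_intros simp: algebra_simps)
  have small: "norm ((\<phi>' s + s * \<phi> s) * of_real (exp (s\<^sup>2 / 2))) \<le> ?K * exp (t\<^sup>2 / 2)"
    if "s \<in> closed_segment 0 t" for s
  proof -
    have st: "\<bar>s\<bar> \<le> \<bar>t\<bar>" using that by (auto simp: closed_segment_eq_real_ivl split: if_splits)
    have s2: "s\<^sup>2 \<le> t\<^sup>2" using st by (simp add: abs_le_square_iff)
    have "\<phi>' s + s * \<phi> s = \<i> * (E (\<lambda>W. ?T W *\<^sub>R iexp (s * ?T W)) - \<i> * s * \<phi> s)"
      by (simp add: \<phi>'_def algebra_simps)
    also have "norm \<dots> \<le> \<bar>s\<bar> * (M / 2 + 2 / real N) + s\<^sup>2 * M"
      unfolding \<phi>_def norm_mult using stein_char_bound[OF assms, of s] by simp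
    also have "\<dots> \<le> ?K"
      using st s2 M by (intro add_mono mult_right_mono) auto
    finally have "norm (\<phi>' s + s * \<phi> s) \<le> ?K" .
    moreover have "exp (s\<^sup>2 / 2) \<le> exp (t\<^sup>2 / 2)" using s2 by simp
    ultimately show ?thesis
      unfolding norm_mult using K by (intro mult_mono) auto
  qed
  have "norm (\<psi> t - \<psi> 0) \<le> ?K * exp (t\<^sup>2 / 2) * norm (t - 0)"
  proof (rule differentiable_bound[of "closed_segment 0 t" \<psi>])
    fix s assume s: "s \<in> closed_segment 0 t"
    show "(\<psi> has_derivative (\<lambda>h. h *\<^sub>R ((\<phi>' s + s * \<phi> s) * of_real (exp (s\<^sup>2 / 2))))) (at s within closed_segment 0 t)"
      using der\<psi> unfolding has_vector_derivative_def .
    show "onorm (\<lambda>h. h *\<^sub>R ((\<phi>' s + s * \<phi> s) * of_real (exp (s\<^sup>2 / 2)))) \<le> ?K * exp (t\<^sup>2 / 2)"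
      using mult_left_mono[OF small[OF s] abs_ge_zero]
      by (intro onorm_le) (simp only: norm_scaleR real_norm_def mult.commute)
  qed auto
  moreover have "\<psi> 0 = 1" by (simp add: \<psi>_def \<phi>_def measure_pmf.prob_space)
  ultimately have "norm (\<psi> t - 1) \<le> \<bar>t\<bar> * ?K * exp (t\<^sup>2 / 2)" by (simp add: mult_ac)
  moreover have "\<phi> t - of_real (exp (- t\<^sup>2 / 2)) = (\<psi> t - 1) * of_real (exp (- t\<^sup>2 / 2))"
    by (simp add: \<psi>_def left_diff_distrib mult.assoc flip: of_real_mult exp_add)
  then have "norm (\<phi> t - of_real (exp (- t\<^sup>2 / 2))) = norm (\<psi> t - 1) * exp (- t\<^sup>2 / 2)"
    by (simp add: norm_mult)
  ultimately have "norm (\<phi> t - of_real (exp (- t\<^sup>2 / 2))) \<le> \<bar>t\<bar> * ?K * exp (t\<^sup>2 / 2) * exp (- t\<^sup>2 / 2)"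
    by (simp only:) (rule mult_right_mono; simp)
  also have "\<dots> = \<bar>t\<bar> * ?K" by (simp add: mult.assoc flip: exp_add)
  finally show ?thesis unfolding \<phi>_def .
qed

end

section \<open>Relative errors of the two observed proportions\<close>

locale randomized_binary = completely_randomized +
  fixes y1 y0 :: "nat \<Rightarrow> real" and \<delta> :: real
  assumes binary: "\<And>i. i \<in> {1..N} \<Longrightarrow> y1 i \<in> {0, 1} \<and> y0 i \<in> {0, 1}"
    and delta: "\<delta> > 0"
    and p1_bounds: "pop_mean N y1 \<in> {\<delta>..1 - \<delta>}"
    and p0_bounds: "pop_mean N y0 \<in> {\<delta>..1 - \<delta>}"
begin

abbreviation p1 :: real where "p1 \<equiv> pop_mean N y1"
abbreviation p0 :: real where "p0 \<equiv> pop_mean N y0"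
abbreviation smaller_arm :: real where "smaller_arm \<equiv> real (min n (N - n))"
abbreviation c1 :: "nat \<Rightarrow> real" where "c1 \<equiv> \<lambda>i. y1 i - p1"
abbreviation c0 :: "nat \<Rightarrow> real" where "c0 \<equiv> \<lambda>i. y0 i - p0"

definition err1 :: "(nat \<Rightarrow> real) \<Rightarrow> real" where
  "err1 W = tsum c1 W / (real n * p1)"

text \<open>
  Centred outcomes add up to 0 over all units, so minus their sum over the treated units is their
  sum over the control arm.
\<close>

definition err0 :: "(nat \<Rightarrow> real) \<Rightarrow> real" where
  "err0 W = - tsum c0 W / (real (N - n) * p0)"

text \<open>
  The weights that make \<open>err1 - err0\<close> a drawn sum. A treated unit enters both errors: \<open>err1\<close> through its
  outcome, \<open>err0\<close> through its absence from the control arm.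
\<close>

definition score :: "nat \<Rightarrow> real" where
  "score i = c1 i / (real n * p1) + c0 i / (real (N - n) * p0)"

abbreviation log_error :: "(nat \<Rightarrow> real) \<Rightarrow> real" where
  "log_error W \<equiv> log_crr_hat N n y1 y0 W - log_crr N y1 y0"

lemma sizes: "real n > 0" "real (N - n) > 0" "real (N - n) = real N - real n" "real N > 1"
  "smaller_arm > 0" "smaller_arm \<le> real n" "smaller_arm \<le> real (N - n)"
  using n_pos n_less by auto

lemma p_pos: "p1 > 0" "p0 > 0" "p1 \<ge> \<delta>" "p0 \<ge> \<delta>" "p1 \<le> 1 - \<delta>" "p0 \<le> 1 - \<delta>"
  using delta p1_bounds p0_bounds by auto

lemma sum_y: "(\<Sum>i=1..N. y1 i) = real N * p1" "(\<Sum>i=1..N. y0 i) = real N * p0"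
  using sizes by (auto simp: pop_mean_def)

lemma sum_c: "(\<Sum>i=1..N. c1 i) = 0" "(\<Sum>i=1..N. c0 i) = 0"
  using sum_y by (auto simp: sum_subtractf)

lemma cell_treated:
  assumes W: "W \<in> assignments N n"
  shows "cell N y1 y0 1 1 W = real n * p1 * (1 + err1 W)"
    and "cell N y1 y0 1 0 W = real n * (1 - p1 * (1 + err1 W))"
proof -
  have "cell N y1 y0 1 1 W = real (card {i \<in> treated W. y1 i = 1})"
    unfolding cell_def by (intro arg_cong[of _ _ real] arg_cong[of _ _ card]) (auto simp: treated_def y_obs_def)
  also have "\<dots> = (\<Sum>i\<in>treated W. if y1 i = 1 then 1 else 0)"
    by (subst sum.inter_filter[symmetric]) (auto simp: treated_def)
  also have "\<dots> = (\<Sum>i\<in>treated W. y1 i)"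
    by (rule sum.cong) (use binary in \<open>auto simp: treated_def\<close>)
  also have "\<dots> = tsum y1 W" by (rule sum_treated[OF W])
  finally have t: "cell N y1 y0 1 1 W = tsum y1 W" .
  then show 1: "cell N y1 y0 1 1 W = real n * p1 * (1 + err1 W)"
    using tsum_center[OF W, of y1 p1] sizes p_pos by (simp add: err1_def field_simps)
  have "cell N y1 y0 1 0 W = real (card {i \<in> treated W. y1 i = 0})"
    unfolding cell_def by (intro arg_cong[of _ _ real] arg_cong[of _ _ card]) (auto simp: treated_def y_obs_def)
  also have "\<dots> = (\<Sum>i\<in>treated W. if y1 i = 0 then 1 else 0)"
    by (subst sum.inter_filter[symmetric]) (auto simp: treated_def)
  also have "\<dots> = (\<Sum>i\<in>treated W. 1 - y1 i)"
    by (rule sum.cong) (use binary in \<open>auto simp: treated_def\<close>)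
  also have "\<dots> = real n - tsum y1 W"
    using sum_treated[OF W, of y1] card_treated[OF W] by (simp add: sum_subtractf)
  finally show "cell N y1 y0 1 0 W = real n * (1 - p1 * (1 + err1 W))"
    using 1 t by (simp add: algebra_simps)
qed

lemma cell_control:
  assumes W: "W \<in> assignments N n"
  shows "cell N y1 y0 0 1 W = real (N - n) * p0 * (1 + err0 W)"
    and "cell N y1 y0 0 0 W = real (N - n) * (1 - p0 * (1 + err0 W))"
proof -
  have "cell N y1 y0 0 1 W = real (card {i \<in> untreated W. y0 i = 1})"
    unfolding cell_def by (intro arg_cong[of _ _ real] arg_cong[of _ _ card]) (auto simp: untreated_def y_obs_def)
  also have "\<dots> = (\<Sum>i\<in>untreated W. if y0 i = 1 then 1 else 0)"
    by (subst sum.inter_filter[symmetric]) (auto simp: untreated_def)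
  also have "\<dots> = (\<Sum>i\<in>untreated W. y0 i)"
    by (rule sum.cong) (use binary in \<open>auto simp: untreated_def\<close>)
  finally have t: "cell N y1 y0 0 1 W = real N * p0 - tsum y0 W"
    using sum_untreated[OF W, of y0] sum_y by simp
  have "real (N - n) * p0 * err0 W = - tsum c0 W"
    using sizes(2) p_pos(2) by (simp add: err0_def)
  then show 1: "cell N y1 y0 0 1 W = real (N - n) * p0 * (1 + err0 W)"
    using tsum_center[OF W, of y0 p0] t sizes(3) by (simp add: algebra_simps)
  have "cell N y1 y0 0 0 W = real (card {i \<in> untreated W. y0 i = 0})"
    unfolding cell_def by (intro arg_cong[of _ _ real] arg_cong[of _ _ card]) (auto simp: untreated_def y_obs_def)
  also have "\<dots> = (\<Sum>i\<in>untreated W. if y0 i = 0 then 1 else 0)"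
    by (subst sum.inter_filter[symmetric]) (auto simp: untreated_def)
  also have "\<dots> = (\<Sum>i\<in>untreated W. 1 - y0 i)"
    by (rule sum.cong) (use binary in \<open>auto simp: untreated_def\<close>)
  also have "\<dots> = real (N - n) - (real N * p0 - tsum y0 W)"
    using sum_untreated[OF W, of y0] sum_y card_untreated[OF W] sizes(3) by (simp add: sum_subtractf)
  finally show "cell N y1 y0 0 0 W = real (N - n) * (1 - p0 * (1 + err0 W))"
    using 1 t by (simp add: algebra_simps)
qed

text \<open>
  Relative errors of absolute value below 1 exclude empty cells \<open>n\<^sub>1\<^sub>1\<close> and \<open>n\<^sub>0\<^sub>1\<close>, so that the
  conventional value of \<open>ln 0\<close> does not enter.
\<close>

lemma log_error_eq:
  assumes W: "W \<in> assignments N n" and "\<bar>err1 W\<bar> < 1" "\<bar>err0 W\<bar> < 1"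
  shows "log_error W = ln (1 + err1 W) - ln (1 + err0 W)"
proof -
  have "p1_hat N n y1 y0 W = p1 * (1 + err1 W)" "p0_hat N n y1 y0 W = p0 * (1 + err0 W)"
    using sizes by (simp_all add: p1_hat_def p0_hat_def cell_treated[OF W] cell_control[OF W])
  then show ?thesis
    using assms p_pos by (simp add: log_crr_hat_def log_crr_def ln_mult_pos)
qed

lemma score_centred: "(\<Sum>i=1..N. score i) = 0"
  unfolding score_def sum.distrib sum_divide_distrib[symmetric] sum_c by simp

lemma tsum_score: "tsum score W = err1 W - err0 W"
proof -
  have "tsum score W = (\<Sum>i=1..N. W i * c1 i / (real n * p1) + W i * c0 i / (real (N - n) * p0))"
    unfolding tsum_def score_def by (simp add: distrib_left)
  also have "\<dots> = tsum c1 W / (real n * p1) + tsum c0 W / (real (N - n) * p0)"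
    unfolding sum.distrib sum_divide_distrib[symmetric] tsum_def ..
  finally show ?thesis by (simp add: err1_def err0_def)
qed

text \<open>
  The covariance of the two potential outcomes enters through
  \<open>2 * \<Sum> c1 c0 = \<Sum> c1\<^sup>2 + \<Sum> c0\<^sup>2 - \<Sum> (c1 - c0)\<^sup>2\<close>, which is where the variance of the unit effects
  comes from.
\<close>

lemma variance_score: "E (\<lambda>W. (tsum score W)\<^sup>2) = avar_crr N n y1 y0"
proof -
  let ?n0 = "real (N - n)"
  define s1 s0 st where "s1 = pop_var N y1" and "s0 = pop_var N y0"
    and "st = pop_var N (unit_effect y1 y0)"
  have ss: "(\<Sum>i=1..N. (c1 i)\<^sup>2) = (real N - 1) * s1" "(\<Sum>i=1..N. (c0 i)\<^sup>2) = (real N - 1) * s0"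
    using sizes by (auto simp: s1_def s0_def pop_var_def)
  have "pop_mean N (unit_effect y1 y0) = p1 - p0"
    by (simp add: pop_mean_def unit_effect_def sum_subtractf diff_divide_distrib)
  then have "unit_effect y1 y0 i - pop_mean N (unit_effect y1 y0) = c1 i - c0 i" for i
    by (simp add: unit_effect_def)
  then have "(real N - 1) * st = (\<Sum>i=1..N. (c1 i - c0 i)\<^sup>2)"
    using sizes(4) unfolding st_def pop_var_def by simp
  also have "\<dots> = (\<Sum>i=1..N. (c1 i)\<^sup>2 + (c0 i)\<^sup>2 - 2 * (c1 i * c0 i))"
    by (simp only: power2_diff mult.assoc)
  also have "\<dots> = (real N - 1) * s1 + (real N - 1) * s0 - 2 * (\<Sum>i=1..N. c1 i * c0 i)"
    unfolding sum_subtractf sum.distrib ss sum_distrib_left ..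
  finally have cross: "2 * (\<Sum>i=1..N. c1 i * c0 i) = (real N - 1) * (s1 + s0 - st)"
    by (simp add: algebra_simps)
  have square: "(x / a + y / b)\<^sup>2 = x\<^sup>2 / a\<^sup>2 + y\<^sup>2 / b\<^sup>2 + 2 * (x * y) / (a * b)" for x y a b :: real
    by (simp add: power2_sum power_divide)
  have "(\<Sum>i=1..N. (score i)\<^sup>2) = (\<Sum>i=1..N. (c1 i)\<^sup>2 / (real n * p1)\<^sup>2 + (c0 i)\<^sup>2 / (?n0 * p0)\<^sup>2
     + 2 * (c1 i * c0 i) / (real n * p1 * (?n0 * p0)))"
    by (simp only: score_def square)
  also have "\<dots> = (real N - 1) * s1 / (real n * p1)\<^sup>2 + (real N - 1) * s0 / (?n0 * p0)\<^sup>2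
     + (real N - 1) * (s1 + s0 - st) / (real n * p1 * (?n0 * p0))"
    unfolding sum.distrib sum_divide_distrib[symmetric] sum_distrib_left[symmetric] ss cross ..
  also have "\<dots> = (real N - 1) * (s1 / (real n * p1)\<^sup>2 + s0 / (?n0 * p0)\<^sup>2
     + (s1 + s0 - st) / (real n * p1 * (?n0 * p0)))"
    by (simp add: distrib_left)
  finally have sq: "(\<Sum>i=1..N. (score i)\<^sup>2) = (real N - 1) * (s1 / (real n * p1)\<^sup>2 + s0 / (?n0 * p0)\<^sup>2
     + (s1 + s0 - st) / (real n * p1 * (?n0 * p0)))" .
  have "a * b / (c * (c - 1)) * ((c - 1) * (s1 / (a * q1)\<^sup>2 + s0 / (b * q0)\<^sup>2
     + (s1 + s0 - st) / (a * q1 * (b * q0)))) =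
    (a * q1 + b * q0) / (c * q1 * q0) * (s1 / (a * q1) + s0 / (b * q0) - st / (a * q1 + b * q0))"
    if pos: "a > 0" "b > 0" "c > 1" "q1 > 0" "q0 > 0" for a b c q1 q0 :: real
  proof -
    have "a * q1 + b * q0 > 0" using pos by (intro add_pos_pos) auto
    then have 1: "(a * q1 + b * q0) / (c * q1 * q0) * (s1 / (a * q1) + s0 / (b * q0) - st / (a * q1 + b * q0))
      = ((a * q1 + b * q0) * (s1 / (a * q1) + s0 / (b * q0)) - st) / (c * q1 * q0)"
      by (simp add: right_diff_distrib diff_divide_distrib)
    show ?thesis unfolding 1 using pos
      by (simp add: divide_simps power2_eq_square) (simp add: algebra_simps)
  qed
  from this[of "real n" ?n0 "real N" p1 p0]
  show ?thesis
    unfolding variance_tsum[OF score_centred] sq avar_crr_def Let_def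
    using sizes p_pos by (simp add: s1_def s0_def st_def)
qed

lemma score_bound:
  assumes "i \<in> {1..N}"
  shows "\<bar>score i\<bar> \<le> 2 / (\<delta> * smaller_arm)"
proof -
  have c: "\<bar>c1 i\<bar> \<le> 1" "\<bar>c0 i\<bar> \<le> 1"
    using binary[OF assms] p_pos delta by auto
  have "\<bar>c1 i / (real n * p1)\<bar> \<le> 1 / (\<delta> * smaller_arm)"
    unfolding abs_divide using c sizes p_pos delta
    by (intro frac_le) (auto simp: abs_mult mult.commute[of \<delta>] intro!: mult_mono)
  moreover have "\<bar>c0 i / (real (N - n) * p0)\<bar> \<le> 1 / (\<delta> * smaller_arm)"
    unfolding abs_divide using c sizes p_pos delta
    by (intro frac_le) (auto simp: abs_mult mult.commute[of \<delta>] intro!: mult_mono)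
  ultimately show ?thesis
    using abs_triangle_ineq[of "c1 i / (real n * p1)" "c0 i / (real (N - n) * p0)"]
    unfolding score_def by simp
qed

definition sq_err :: "(nat \<Rightarrow> real) \<Rightarrow> real" where
  "sq_err W = (err1 W)\<^sup>2 + (err0 W)\<^sup>2"

lemma variance_centred_outcome:
  assumes y: "\<And>i. i \<in> {1..N} \<Longrightarrow> y i \<in> {0, 1}"
  shows "E (\<lambda>W. (tsum (\<lambda>i. y i - pop_mean N y) W)\<^sup>2) \<le> real n * (real N - real n) / (real N - 1)"
proof -
  have "(\<Sum>i=1..N. (y i - pop_mean N y)\<^sup>2) \<le> (\<Sum>i=1..N. (y i)\<^sup>2)"
    by (rule sum_sq_deviation_le)
  also have "\<dots> \<le> (\<Sum>i=1..N. 1)" using y by (intro sum_mono) fastforce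
  finally have s: "(\<Sum>i=1..N. (y i - pop_mean N y)\<^sup>2) \<le> real N" by simp
  have "(\<Sum>i=1..N. y i - pop_mean N y) = 0"
    using sizes by (simp add: sum_subtractf pop_mean_def)
  from variance_tsum[OF this]
  have "E (\<lambda>W. (tsum (\<lambda>i. y i - pop_mean N y) W)\<^sup>2) \<le>
      real n * (real N - real n) / (real N * (real N - 1)) * real N"
    using s sizes by (simp add: mult_left_mono del: times_divide_eq_left)
  also have "\<dots> = real n * (real N - real n) / (real N - 1)"
    using sizes by simp
  finally show ?thesis .
qed

text \<open>
  Each observed proportion has variance at most one over the size of its own arm, whatever the
  size of the other one.
\<close>

lemma E_sq_err: "E sq_err \<le> 2 / (\<delta>\<^sup>2 * smaller_arm)"
proof -
  have scale: "v / (m * p)\<^sup>2 \<le> 1 / (\<delta>\<^sup>2 * smaller_arm)"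
    if "v \<le> m" "smaller_arm \<le> m" "\<delta> \<le> p" for v m p
  proof -
    have m: "m > 0" using that sizes by linarith
    have p: "p > 0" using that delta by linarith
    have "v / (m * p)\<^sup>2 \<le> m / (m * p)\<^sup>2" using that by (intro divide_right_mono) auto
    also have "\<dots> = 1 / (p\<^sup>2 * m)" using m by (simp add: power2_eq_square)
    also have "\<dots> \<le> 1 / (\<delta>\<^sup>2 * smaller_arm)"
      using that sizes delta m p by (intro divide_left_mono mult_mono power_mono) auto
    finally show ?thesis .
  qed
  have v: "real n * (real N - real n) / (real N - 1) \<le> real n"
    "real n * (real N - real n) / (real N - 1) \<le> real (N - n)"
    using sizes n_pos by (auto simp: divide_le_eq mult_left_mono mult.commute intro!: mult_right_mono)
  have "E (\<lambda>W. (err1 W)\<^sup>2) = E (\<lambda>W. (tsum c1 W)\<^sup>2) / (real n * p1)\<^sup>2"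
    by (simp add: err1_def power_divide)
  also have "\<dots> \<le> 1 / (\<delta>\<^sup>2 * smaller_arm)"
    using variance_centred_outcome[of y1] binary v sizes p_pos by (intro scale) auto
  finally have 1: "E (\<lambda>W. (err1 W)\<^sup>2) \<le> 1 / (\<delta>\<^sup>2 * smaller_arm)" .
  have "E (\<lambda>W. (err0 W)\<^sup>2) = E (\<lambda>W. (tsum c0 W)\<^sup>2) / (real (N - n) * p0)\<^sup>2"
    by (simp add: err0_def power_divide)
  also have "\<dots> \<le> 1 / (\<delta>\<^sup>2 * smaller_arm)"
    using variance_centred_outcome[of y0] binary v sizes p_pos by (intro scale) auto
  finally have "E (\<lambda>W. (err0 W)\<^sup>2) \<le> 1 / (\<delta>\<^sup>2 * smaller_arm)" .
  with 1 show ?thesis by (simp add: sq_err_def[abs_def])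
qed

text \<open>
  Both convergences in probability are proved with this Markov bound: it suffices to show
  that a small \<open>sq_err\<close> rules out the exceptional event.
\<close>

lemma prob_sq_err:
  assumes "h > 0" and good: "\<And>W. W \<in> assignments N n \<Longrightarrow> sq_err W < h \<Longrightarrow> \<not> P W"
  shows "measure_pmf.prob (cre N n) {W. P W} \<le> 2 / (\<delta>\<^sup>2 * h) * (1 / smaller_arm)"
proof -
  have "measure_pmf.prob (cre N n) {W. P W} \<le> measure_pmf.prob (cre N n) {W. h \<le> sq_err W}"
    using good by (intro measure_pmf.finite_measure_mono_AE)
      (auto simp: AE_measure_pmf_iff set_pmf_cre not_less[symmetric])
  also have "\<dots> \<le> E sq_err / h"
    by (rule integral_pmf_nonneg_markov) (auto simp: set_pmf_cre finite_assignments sq_err_def \<open>h > 0\<close>)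
  also have "\<dots> \<le> 2 / (\<delta>\<^sup>2 * smaller_arm) / h"
    using E_sq_err \<open>h > 0\<close> by (intro divide_right_mono) auto
  finally show ?thesis by (simp add: mult_ac)
qed

lemma log_error_linearisation:
  assumes W: "W \<in> assignments N n" and small: "sq_err W < 1 / 4"
  shows "\<bar>log_error W - tsum score W\<bar> \<le> 2 * sq_err W"
    and "(log_error W)\<^sup>2 \<le> 8 * sq_err W"
proof -
  have "(err1 W)\<^sup>2 \<le> 1 / 4" "(err0 W)\<^sup>2 \<le> 1 / 4"
    using small zero_le_power2[of "err1 W"] zero_le_power2[of "err0 W"]
    unfolding sq_err_def by linarith+
  then have "(err1 W)\<^sup>2 \<le> (1 / 2)\<^sup>2" "(err0 W)\<^sup>2 \<le> (1 / 2)\<^sup>2"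
    by (simp_all add: power_divide)
  then have e: "\<bar>err1 W\<bar> \<le> 1 / 2" "\<bar>err0 W\<bar> \<le> 1 / 2"
    by (metis abs_le_square_iff abs_of_nonneg zero_le_divide_1_iff zero_le_numeral)+
  have eq: "log_error W = ln (1 + err1 W) - ln (1 + err0 W)"
    by (rule log_error_eq[OF W]) (use e in auto)
  have l: "\<bar>ln (1 + err1 W) - err1 W\<bar> \<le> 2 * (err1 W)\<^sup>2" "\<bar>ln (1 + err0 W) - err0 W\<bar> \<le> 2 * (err0 W)\<^sup>2"
    using e by (auto intro: abs_ln_one_plus_x_minus_x_bound)
  show "\<bar>log_error W - tsum score W\<bar> \<le> 2 * sq_err W"
  proof -
    have "\<bar>x - a\<bar> \<le> u \<Longrightarrow> \<bar>y - b\<bar> \<le> v \<Longrightarrow> \<bar>(x - y) - (a - b)\<bar> \<le> u + v" for x y a b u v :: real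
      by linarith
    from this[OF l] show ?thesis unfolding eq tsum_score sq_err_def by (simp only: distrib_left)
  qed
  have lip: "2 * x\<^sup>2 \<le> \<bar>x\<bar>" if "\<bar>x\<bar> \<le> 1 / 2" for x :: real
    using mult_right_mono[OF that, of "\<bar>x\<bar>"] by (simp add: power2_eq_square flip: abs_mult)
  have "\<bar>log_error W\<bar> \<le> 2 * \<bar>err1 W\<bar> + 2 * \<bar>err0 W\<bar>"
    unfolding eq using l lip[OF e(1)] lip[OF e(2)] by linarith
  then have "(log_error W)\<^sup>2 \<le> (2 * \<bar>err1 W\<bar> + 2 * \<bar>err0 W\<bar>)\<^sup>2"
    by (simp add: abs_le_square_iff[symmetric])
  also have "\<dots> \<le> 8 * sq_err W"
    using zero_le_power2[of "\<bar>err1 W\<bar> - \<bar>err0 W\<bar>"]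
    unfolding sq_err_def power2_sum power2_diff by (simp add: power_mult_distrib)
  finally show "(log_error W)\<^sup>2 \<le> 8 * sq_err W" .
qed

text \<open>
  The central limit theorem is applied to the scores divided by \<open>s\<close>, which are bounded by \<open>M\<close>. The passage
  from the linear part to \<open>log_error\<close> costs at most \<open>2 * \<bar>t\<bar> / s * sq_err\<close> where \<open>sq_err < 1/4\<close>.
  Elsewhere it costs at most 2, hence at most \<open>8 * sq_err\<close>, so that the mean of \<open>sq_err\<close> bounds
  both.
\<close>

theorem char_log_error_bound:
  fixes t :: real
  defines "s \<equiv> sqrt (avar_crr N n y1 y0)"
  defines "M \<equiv> 2 / \<delta> * (1 / (smaller_arm * s))"
  assumes avar: "avar_crr N n y1 y0 > 0"
  shows "norm (E (\<lambda>W. iexp (t * (log_error W / s))) - of_real (exp (- t\<^sup>2 / 2)))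
    \<le> 4 * \<bar>t\<bar> / \<delta>\<^sup>2 * (1 / (smaller_arm * s)) + 16 / \<delta>\<^sup>2 * (1 / smaller_arm)
      + \<bar>t\<bar> * (\<bar>t\<bar> * (M / 2 + 2 * (1 / real N)) + t\<^sup>2 * M)"
proof -
  have s: "s > 0" "s\<^sup>2 = avar_crr N n y1 y0" using avar by (auto simp: s_def)
  define a where "a i = score i / s" for i
  have ta: "tsum a W = tsum score W / s" for W
    by (simp add: tsum_def a_def sum_divide_distrib)
  have clt: "norm (E (\<lambda>W. iexp (t * tsum a W)) - of_real (exp (- t\<^sup>2 / 2)))
    \<le> \<bar>t\<bar> * (\<bar>t\<bar> * (M / 2 + 2 / real N) + t\<^sup>2 * M)"
  proof (rule char_tsum_bound)
    show "(\<Sum>i=1..N. a i) = 0"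
      unfolding a_def sum_divide_distrib[symmetric] score_centred by simp
    show "E (\<lambda>W. (tsum a W)\<^sup>2) = 1"
      using avar variance_score s by (simp add: ta power_divide)
    show "\<bar>a i\<bar> \<le> M" if "i \<in> {1..N}" for i
      using divide_right_mono[OF score_bound[OF that], of s] s
      by (simp add: a_def M_def mult_ac)
  qed
  have "norm (E (\<lambda>W. iexp (t * (log_error W / s))) - E (\<lambda>W. iexp (t * tsum a W))) =
      norm (E (\<lambda>W. iexp (t * (log_error W / s)) - iexp (t * tsum a W)))"
    by (subst Bochner_Integration.integral_diff) simp_all
  also have "\<dots> \<le> E (\<lambda>W. (2 * \<bar>t\<bar> / s + 8) * sq_err W)"
  proof (rule E_norm)
    fix W assume W: "W \<in> assignments N n"
    show "norm (iexp (t * (log_error W / s)) - iexp (t * tsum a W)) \<le> (2 * \<bar>t\<bar> / s + 8) * sq_err W"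
    proof (cases "sq_err W < 1 / 4")
      case True
      let ?x = "t * (log_error W / s)" and ?y = "t * tsum a W"
      have "iexp ?x - iexp ?y = iexp ?y * (iexp (?x - ?y) - 1)"
        by (simp add: right_diff_distrib flip: exp_add) 
      then have "norm (iexp ?x - iexp ?y) = norm (iexp (?x - ?y) - 1)"
        by (simp only: norm_mult norm_exp_i_times mult_1)
      also have "\<dots> \<le> \<bar>?x - ?y\<bar>"
        using iexp_approx1[of "?x - ?y" 0] by simp
      also have "?x - ?y = t / s * (log_error W - tsum score W)"
        by (simp add: ta diff_divide_distrib right_diff_distrib)
      also have "\<bar>\<dots>\<bar> \<le> \<bar>t\<bar> / s * (2 * sq_err W)"
        unfolding abs_mult using log_error_linearisation(1)[OF W True] s
        by (intro mult_mono) auto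
      also have "\<dots> \<le> (2 * \<bar>t\<bar> / s + 8) * sq_err W"
      proof -
        have "(2 * \<bar>t\<bar> / s + 8) * sq_err W = \<bar>t\<bar> / s * (2 * sq_err W) + 8 * sq_err W"
          by (simp add: distrib_right)
        moreover have "sq_err W \<ge> 0" by (simp add: sq_err_def)
        ultimately show ?thesis by linarith
      qed
      finally show ?thesis .
    next
      case False
      have "norm (iexp (t * (log_error W / s)) - iexp (t * tsum a W)) \<le> 2"
        by (rule order_trans[OF norm_triangle_ineq4]) (simp only: norm_exp_i_times)
      also have "\<dots> \<le> 8 * sq_err W" using False by simp
      also have "\<dots> \<le> (2 * \<bar>t\<bar> / s + 8) * sq_err W"
        using s by (simp add: sq_err_def distrib_right)
      finally show ?thesis .
    qed
  qed
  also have "\<dots> = (2 * \<bar>t\<bar> / s + 8) * E sq_err" by simp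
  also have "\<dots> \<le> (2 * \<bar>t\<bar> / s + 8) * (2 / (\<delta>\<^sup>2 * smaller_arm))"
    using E_sq_err s by (intro mult_left_mono) auto
  also have "\<dots> = 4 * \<bar>t\<bar> / \<delta>\<^sup>2 * (1 / (smaller_arm * s)) + 16 / \<delta>\<^sup>2 * (1 / smaller_arm)"
    by (simp add: distrib_right add_divide_distrib mult_ac)
  finally show ?thesis
    using clt norm_triangle_ineq[of "E (\<lambda>W. iexp (t * (log_error W / s))) - E (\<lambda>W. iexp (t * tsum a W))"
        "E (\<lambda>W. iexp (t * tsum a W)) - of_real (exp (- t\<^sup>2 / 2))"]
    by simp
qed

section \<open>The variance estimator without unit effects\<close>

text \<open>
  Zero variance makes all unit effects equal to \<open>p1 - p0\<close>. As both proportions lie in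
  \<open>{\<delta>..1 - \<delta>}\<close>, this is less than 1 in absolute value, whereas the effects are -1, 0 or 1.
\<close>

lemma no_effect_variance_imp_no_effect:
  assumes "pop_var N (unit_effect y1 y0) = 0" "i \<in> {1..N}"
  shows "y1 i = y0 i"
proof -
  let ?\<tau> = "unit_effect y1 y0"
  have "(\<Sum>i=1..N. (?\<tau> i - pop_mean N ?\<tau>)\<^sup>2) = 0"
    using assms(1) sizes by (simp add: pop_var_def)
  then have "?\<tau> i = pop_mean N ?\<tau>"
    using assms(2) by (subst (asm) sum_nonneg_eq_0_iff) auto
  also have "\<dots> = p1 - p0"
    by (simp add: pop_mean_def unit_effect_def sum_subtractf diff_divide_distrib)
  finally have "\<bar>?\<tau> i\<bar> < 1" using p_pos delta by (simp add: abs_less_iff)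
  then show ?thesis using binary[OF assms(2)] by (auto simp: unit_effect_def)
qed

text \<open>
  Without unit effects \<open>p1 = p0 = p\<close>, and the ratio is \<open>(1 - 1/N) * u * v / ((1 + err1) (1 + err0))\<close>,
  where \<open>p * u\<close> and \<open>(1 - p) * v\<close> are averages of the observed success and failure
  proportions, weighted by the arm sizes. The factor \<open>\<delta>\<close> in the smallness condition pays for the division by \<open>1 - p\<close>
  in the relative error of the failure proportions.
\<close>

lemma variance_estimator_ratio:
  assumes no_effect: "pop_var N (unit_effect y1 y0) = 0"
    and W: "W \<in> assignments N n"
    and k: "0 < k" "k \<le> 1 / 4" "1 / real N \<le> k"
    and small: "sq_err W < (k * \<delta>)\<^sup>2"
  shows "\<bar>v_crr_hat N n y1 y0 W / avar_crr N n y1 y0 - 1\<bar> \<le> 8 * k"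
proof -
  define p where "p = p1"
  define a where "a = real n"
  define b where "b = real (N - n)"
  define c where "c = real N"
  define x where "x = 1 + err1 W"
  define z where "z = 1 + err0 W"
  have p0: "p0 = p"
    unfolding p_def pop_mean_def using no_effect_variance_imp_no_effect[OF no_effect] by simp
  have p: "0 < p" "\<delta> \<le> p" "\<delta> \<le> 1 - p" "0 < 1 - p" using p_pos delta by (auto simp: p_def)
  have abc: "a > 0" "b > 0" "c > 1" "a + b = c" using sizes by (auto simp: a_def b_def c_def)
  have "(err1 W)\<^sup>2 \<le> (k * \<delta>)\<^sup>2" "(err0 W)\<^sup>2 \<le> (k * \<delta>)\<^sup>2"
    using small zero_le_power2[of "err1 W"] zero_le_power2[of "err0 W"]
    unfolding sq_err_def by linarith+
  then have e: "\<bar>err1 W\<bar> \<le> k * \<delta>" "\<bar>err0 W\<bar> \<le> k * \<delta>"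
    using k delta by (auto simp flip: abs_le_square_iff)
  have "k * \<delta> \<le> k * 1" using k p by (intro mult_left_mono) auto
  with e have near: "\<bar>x - 1\<bar> \<le> k" "\<bar>z - 1\<bar> \<le> k" by (auto simp: x_def z_def)
  then have xz: "x > 0" "z > 0" using k by auto
  define u where "u = (a * x + b * z) / c"
  define v where "v = (b * (1 - p * x) + a * (1 - p * z)) / (c * (1 - p))"
  have average: "\<bar>(a * s + b * t) / c\<bar> \<le> h" if "\<bar>s\<bar> \<le> h" "\<bar>t\<bar> \<le> h" for s t h
  proof -
    have "\<bar>a * s + b * t\<bar> \<le> a * h + b * h"
      using that abc by (intro order_trans[OF abs_triangle_ineq] add_mono) (auto simp: abs_mult)
    also have "\<dots> = c * h" using abc by (simp flip: distrib_right)
    finally show ?thesis using abc by (simp add: abs_divide divide_le_eq mult.commute)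
  qed
  have "u - 1 = (a * (x - 1) + b * (z - 1)) / c"
    using abc(1-3) by (simp add: u_def abc(4)[symmetric] field_simps)
  then have u: "\<bar>u - 1\<bar> \<le> k" using average near by simp
  have "v - 1 = - (p / (1 - p) * ((a * (z - 1) + b * (x - 1)) / c))"
    using abc(1-3) p unfolding v_def abc(4)[symmetric]
    by (simp add: divide_simps) (simp add: algebra_simps)
  then have "\<bar>v - 1\<bar> = p / (1 - p) * \<bar>(a * (z - 1) + b * (x - 1)) / c\<bar>"
    using p by (simp add: abs_mult)
  also have "\<dots> \<le> 1 / \<delta> * (k * \<delta>)"
    using p delta e by (intro mult_mono average frac_le) (auto simp: x_def z_def)
  finally have v: "\<bar>v - 1\<bar> \<le> k" using delta by simp
  have sq: "(\<Sum>i=1..N. (y i - p)\<^sup>2) = c * p * (1 - p)"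
    if "\<And>i. i \<in> {1..N} \<Longrightarrow> y i \<in> {0, 1}" "(\<Sum>i=1..N. y i) = c * p" for y
  proof -
    have "(\<Sum>i=1..N. (y i - p)\<^sup>2) = (\<Sum>i=1..N. y i * (1 - 2 * p) + p\<^sup>2)"
      by (rule sum.cong) (use that(1) in \<open>fastforce simp: power2_eq_square algebra_simps\<close>)+
    also have "\<dots> = c * p * (1 - 2 * p) + c * p\<^sup>2"
      unfolding sum.distrib sum_distrib_right[symmetric] that(2) by (simp add: c_def)
    finally show ?thesis by (simp add: power2_eq_square algebra_simps)
  qed
  have "pop_var N y1 = c * p * (1 - p) / (c - 1)" "pop_var N y0 = c * p * (1 - p) / (c - 1)"
    using sq[of y1] sq[of y0] binary sum_y p0 by (auto simp: pop_var_def p_def c_def)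
  then have av: "avar_crr N n y1 y0 = (a * p + b * p) / (c * p * p) *
      (c * p * (1 - p) / (c - 1) / (a * p) + c * p * (1 - p) / (c - 1) / (b * p))"
    unfolding avar_crr_def Let_def no_effect p0 by (simp add: a_def b_def c_def flip: p_def)
  also have "\<dots> = c * c * (1 - p) / ((c - 1) * p * a * b)"
    using abc(1-3) p unfolding abc(4)[symmetric] by (simp add: divide_simps) (simp add: algebra_simps)
  finally have av: "avar_crr N n y1 y0 = c * c * (1 - p) / ((c - 1) * p * a * b)" .
  have "v_crr_hat N n y1 y0 W =
      a * (1 - p * x) / (a * p * x * a) * ((a * p * x + b * p * z) * b / (b * p * z * c))
    + b * (1 - p * z) / (b * p * z * b) * ((a * p * x + b * p * z) * a / (a * p * x * c))"
    unfolding v_crr_hat_def Let_def cell_treated[OF W] cell_control[OF W] p0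
    by (simp add: a_def b_def c_def x_def z_def flip: p_def)
  also have "\<dots> = u * v * (c * (1 - p)) / (p * x * z * a * b)"
    using abc(1-3) p xz unfolding u_def v_def
    by (simp add: divide_simps) (simp add: algebra_simps)
  finally have vh: "v_crr_hat N n y1 y0 W = u * v * (c * (1 - p)) / (p * x * z * a * b)" .
  have "v_crr_hat N n y1 y0 W / avar_crr N n y1 y0 = (c - 1) / c * (u * v) / (x * z)"
    unfolding vh av using abc(1-3) p xz by (simp add: divide_simps)
  moreover have "1 - k \<le> (c - 1) / c" "(c - 1) / c \<le> 1"
    using k(3) abc(3) by (auto simp: c_def field_simps)
  ultimately show ?thesis
    using ratio_near_one[OF k(1,2) _ _ u v near, of "(c - 1) / c"] by simp
qed

end

section \<open>Asymptotics of the log risk ratio\<close>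

theorem theorem3:
  fixes y1 y0 :: "nat \<Rightarrow> nat \<Rightarrow> real" and N1 :: "nat \<Rightarrow> nat" and \<delta> :: real
  assumes binary: "\<And>N i. i \<in> {1..N} \<Longrightarrow> y1 N i \<in> {0, 1} \<and> y0 N i \<in> {0, 1}"
    and treated: "filterlim N1 at_top sequentially"
    and control: "filterlim (\<lambda>N. N - N1 N) at_top sequentially"
    and delta: "\<delta> > 0"
    and p1_bounded: "\<forall>\<^sub>F N in sequentially. pop_mean N (y1 N) \<in> {\<delta>..1 - \<delta>}"
    and p0_bounded: "\<forall>\<^sub>F N in sequentially. pop_mean N (y0 N) \<in> {\<delta>..1 - \<delta>}"
  shows "tendsto_in_prob (\<lambda>N. cre N (N1 N))
           (\<lambda>N W. log_crr_hat N (N1 N) (y1 N) (y0 N) W - log_crr N (y1 N) (y0 N)) 0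
       \<and> (filterlim (\<lambda>N. (real (min (N1 N) (N - N1 N)))\<^sup>2 * avar_crr N (N1 N) (y1 N) (y0 N))
             at_top sequentially \<longrightarrow>
          weak_conv_m
            (\<lambda>N. distr (measure_pmf (cre N (N1 N))) borel
              (\<lambda>W. (log_crr_hat N (N1 N) (y1 N) (y0 N) W - log_crr N (y1 N) (y0 N))
                     / sqrt (avar_crr N (N1 N) (y1 N) (y0 N))))
            std_normal_distribution)
       \<and> ((\<forall>\<^sub>F N in sequentially. pop_var N (unit_effect (y1 N) (y0 N)) = 0) \<longrightarrow>
          tendsto_in_prob (\<lambda>N. cre N (N1 N))
            (\<lambda>N W. v_crr_hat N (N1 N) (y1 N) (y0 N) W / avar_crr N (N1 N) (y1 N) (y0 N)) 1)"
proof -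
  define m where "m N = real (min (N1 N) (N - N1 N))" for N
  define s where "s N = sqrt (avar_crr N (N1 N) (y1 N) (y0 N))" for N
  let ?P = "\<lambda>N. cre N (N1 N)"
  let ?R = "\<lambda>N. randomized_binary.sq_err N (N1 N) (y1 N) (y0 N)"
  have regular: "\<forall>\<^sub>F N in sequentially. randomized_binary N (N1 N) (y1 N) (y0 N) \<delta>"
    using eventually_compose_filterlim[OF eventually_gt_at_top[of 0] treated]
      eventually_compose_filterlim[OF eventually_gt_at_top[of 0] control] p1_bounded p0_bounded
  proof eventually_elim
    case (elim N)
    then show ?case using binary[of _ N] delta by unfold_locales auto
  qed
  have "filterlim m at_top sequentially"
    unfolding m_def
  proof (rule filterlim_compose[OF filterlim_real_sequentially])
    show "filterlim (\<lambda>N. min (N1 N) (N - N1 N)) at_top sequentially"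
      unfolding filterlim_at_top
    proof
      fix Z
      show "\<forall>\<^sub>F N in sequentially. Z \<le> min (N1 N) (N - N1 N)"
        using eventually_compose_filterlim[OF eventually_ge_at_top[of Z] treated]
          eventually_compose_filterlim[OF eventually_ge_at_top[of Z] control]
        by eventually_elim simp
    qed
  qed
  then have inv_m: "(\<lambda>N. 1 / m N) \<longlonglongrightarrow> 0"
    by (rule tendsto_divide_0[OF tendsto_const filterlim_at_top_imp_at_infinity])
  have tail: "(\<lambda>N. measure_pmf.prob (?P N) {W. A N W}) \<longlonglongrightarrow> 0"
    if "h > 0" and good: "\<forall>\<^sub>F N in sequentially. \<forall>W\<in>assignments N (N1 N). ?R N W < h \<longrightarrow> \<not> A N W"
    for h and A :: "nat \<Rightarrow> (nat \<Rightarrow> real) \<Rightarrow> bool"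
  proof (rule tendsto_sandwich[OF _ _ tendsto_const tendsto_mult_right_zero[OF inv_m]])
    show "\<forall>\<^sub>F N in sequentially. measure_pmf.prob (?P N) {W. A N W} \<le> 2 / (\<delta>\<^sup>2 * h) * (1 / m N)"
      using regular good
    proof eventually_elim
      case (elim N)
      interpret randomized_binary N "N1 N" "y1 N" "y0 N" \<delta> by (rule elim)
      show ?case unfolding m_def using elim(2) by (intro prob_sq_err \<open>h > 0\<close>) auto
    qed
  qed simp
  have consistent: "tendsto_in_prob ?P
      (\<lambda>N W. log_crr_hat N (N1 N) (y1 N) (y0 N) W - log_crr N (y1 N) (y0 N)) 0"
    unfolding tendsto_in_prob_def
  proof (intro allI impI)
    fix \<epsilon> :: real
    assume \<epsilon>: "\<epsilon> > 0"
    show "(\<lambda>N. measure_pmf.prob (?P N) {W.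
        \<bar>log_crr_hat N (N1 N) (y1 N) (y0 N) W - log_crr N (y1 N) (y0 N) - 0\<bar> > \<epsilon>}) \<longlonglongrightarrow> 0"
    proof (rule tail)
      show "min (1 / 4) (\<epsilon>\<^sup>2 / 8) > 0" using \<epsilon> by simp
      show "\<forall>\<^sub>F N in sequentially. \<forall>W\<in>assignments N (N1 N). ?R N W < min (1 / 4) (\<epsilon>\<^sup>2 / 8) \<longrightarrow>
          \<not> \<bar>log_crr_hat N (N1 N) (y1 N) (y0 N) W - log_crr N (y1 N) (y0 N) - 0\<bar> > \<epsilon>"
        using regular
      proof eventually_elim
        case (elim N)
        interpret randomized_binary N "N1 N" "y1 N" "y0 N" \<delta> by (rule elim)
        show ?case
        proof (intro ballI impI)
          fix W assume W: "W \<in> assignments N (N1 N)" and R: "sq_err W < min (1 / 4) (\<epsilon>\<^sup>2 / 8)"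
          have "(log_error W)\<^sup>2 \<le> \<epsilon>\<^sup>2"
            using log_error_linearisation(2)[OF W] R by simp
          then have "\<bar>log_error W\<bar> \<le> \<epsilon>" using \<epsilon> by (simp flip: abs_le_square_iff)
          then show "\<not> \<bar>log_error W - 0\<bar> > \<epsilon>" by simp
        qed
      qed
    qed
  qed
  have normal: "weak_conv_m (\<lambda>N. distr (measure_pmf (?P N)) borel
      (\<lambda>W. (log_crr_hat N (N1 N) (y1 N) (y0 N) W - log_crr N (y1 N) (y0 N))
        / sqrt (avar_crr N (N1 N) (y1 N) (y0 N)))) std_normal_distribution"
    if nondegenerate: "filterlim (\<lambda>N. (real (min (N1 N) (N - N1 N)))\<^sup>2 * avar_crr N (N1 N) (y1 N) (y0 N))
             at_top sequentially"
  proof (rule weak_conv_std_normal_if_char, rule LIM_zero_cancel, rule Lim_null_comparison)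
    fix t :: real
    \<comment> \<open>The nondegeneracy condition in the form in which it enters the bound: \<open>m * s\<close> tends to infinity\<close>
    have "filterlim (\<lambda>N. sqrt ((m N)\<^sup>2 * avar_crr N (N1 N) (y1 N) (y0 N))) at_top sequentially"
      using filterlim_compose[OF sqrt_at_top nondegenerate] by (simp add: m_def)
    then have "filterlim (\<lambda>N. m N * s N) at_top sequentially"
      by (simp add: real_sqrt_mult s_def m_def)
    then have inv_ms: "(\<lambda>N. 1 / (m N * s N)) \<longlonglongrightarrow> 0"
      by (rule tendsto_divide_0[OF tendsto_const filterlim_at_top_imp_at_infinity])
    define M where "M N = 2 / \<delta> * (1 / (m N * s N))" for N
    have M: "M \<longlonglongrightarrow> 0" unfolding M_def by (rule tendsto_mult_right_zero[OF inv_ms])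
    let ?bound = "\<lambda>N. 4 * \<bar>t\<bar> / \<delta>\<^sup>2 * (1 / (m N * s N)) + 16 / \<delta>\<^sup>2 * (1 / m N)
        + \<bar>t\<bar> * (\<bar>t\<bar> * (M N / 2 + 2 * (1 / real N)) + t\<^sup>2 * M N)"
    have "?bound \<longlonglongrightarrow> 4 * \<bar>t\<bar> / \<delta>\<^sup>2 * 0 + 16 / \<delta>\<^sup>2 * 0 + \<bar>t\<bar> * (\<bar>t\<bar> * (0 / 2 + 2 * 0) + t\<^sup>2 * 0)"
      by (intro tendsto_intros inv_ms inv_m M lim_1_over_n) simp_all
    then show "?bound \<longlonglongrightarrow> 0" by simp
    have "\<forall>\<^sub>F N in sequentially. 1 \<le> (real (min (N1 N) (N - N1 N)))\<^sup>2 * avar_crr N (N1 N) (y1 N) (y0 N)"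
      using nondegenerate by (simp add: filterlim_at_top)
    then show "\<forall>\<^sub>F N in sequentially. norm (measure_pmf.expectation (?P N)
        (\<lambda>W. iexp (t * ((log_crr_hat N (N1 N) (y1 N) (y0 N) W - log_crr N (y1 N) (y0 N))
        / sqrt (avar_crr N (N1 N) (y1 N) (y0 N))))) - of_real (exp (- t\<^sup>2 / 2))) \<le> ?bound N"
      using regular
    proof eventually_elim
      case (elim N)
      interpret randomized_binary N "N1 N" "y1 N" "y0 N" \<delta> by (rule elim)
      have "0 < smaller_arm\<^sup>2 * avar_crr N (N1 N) (y1 N) (y0 N)" using elim(1) by linarith
      then have "avar_crr N (N1 N) (y1 N) (y0 N) > 0"
        by (simp add: zero_less_mult_iff)
      from char_log_error_bound[OF this, of t]
      show ?case unfolding M_def m_def s_def .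
    qed
  qed
  have estimator: "tendsto_in_prob ?P
      (\<lambda>N W. v_crr_hat N (N1 N) (y1 N) (y0 N) W / avar_crr N (N1 N) (y1 N) (y0 N)) 1"
    if no_effect: "\<forall>\<^sub>F N in sequentially. pop_var N (unit_effect (y1 N) (y0 N)) = 0"
    unfolding tendsto_in_prob_def
  proof (intro allI impI)
    fix \<epsilon> :: real
    assume \<epsilon>: "\<epsilon> > 0"
    define k where "k = min (1 / 4) (\<epsilon> / 8)"
    have k: "0 < k" "k \<le> 1 / 4" "8 * k \<le> \<epsilon>" using \<epsilon> by (auto simp: k_def)
    show "(\<lambda>N. measure_pmf.prob (?P N) {W.
        \<bar>v_crr_hat N (N1 N) (y1 N) (y0 N) W / avar_crr N (N1 N) (y1 N) (y0 N) - 1\<bar> > \<epsilon>}) \<longlonglongrightarrow> 0"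
    proof (rule tail)
      show "(k * \<delta>)\<^sup>2 > 0" using k delta by simp
      have "\<forall>\<^sub>F N in sequentially. 1 / real N < k"
        using order_tendstoD(2)[OF lim_1_over_n k(1)] .
      then show "\<forall>\<^sub>F N in sequentially. \<forall>W\<in>assignments N (N1 N). ?R N W < (k * \<delta>)\<^sup>2 \<longrightarrow>
          \<not> \<bar>v_crr_hat N (N1 N) (y1 N) (y0 N) W / avar_crr N (N1 N) (y1 N) (y0 N) - 1\<bar> > \<epsilon>"
        using regular no_effect
      proof eventually_elim
        case (elim N)
        interpret randomized_binary N "N1 N" "y1 N" "y0 N" \<delta> by (rule elim)
        show ?case
          using variance_estimator_ratio[OF elim(3) _ k(1,2)] elim(1) k(3) by fastforce
      qed
    qed
  qed
  show ?thesis using consistent normal estimator by blast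
qed

end
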